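(* Let $\rho$ be a mixed (i.e. not pure, rank at least two) two-qubit density matrix, and let $R$ be the real $4\times4$ matrix with elements $R_{ij}=\operatorname{Tr}(\rho(\sigma_i\otimes\sigma_j))$, $i,j\in\{0,1,2,3\}$. Then $\rho$ can be quasi-purified to the singlet state by single copy filtering operations if and only if $\rho$ has rank two and $R=L_1\Sigma L_2^T$ for some proper orthochronous Lorentz transformations $L_1,L_2$ and some $$\Sigma=\begin{pmatrix}a&0&0&b\\0&d&0&0\\0&0&-d&0\\c&0&0&a+c-b\end{pmatrix}$$ with $a,b,c,d$ real and $a-b=a+c=|d|$.
   Context: A two-qubit density matrix is a positive semidefinite complex $4\times4$ matrix on $\mathbb{C}^2\otimes\mathbb{C}^2$ of trace one. $\sigma_0=I_2$ and $\sigma_1=\begin{pmatrix}0&1\\1&0\end{pmatrix}$, $\sigma_2=\begin{pmatrix}0&-i\\i&0\end{pmatrix}$, $\sigma_3=\begin{pmatrix}1&0\\0&-1\end{pmatrix}$ are the Pauli matrices. With $M=\operatorname{diag}[1,-1,-1,-1]$, a proper orthochronous Lorentz transformation is a real $4\times4$ matrix $L$ (indices $0,\dots,3$) with $LML^T=M$, $\det L=1$ and $L_{00}>0$. A single copy filtering operation maps $\rho$ to $\rho'=(A\otimes B)\rho(A\otimes B)^\dagger/\operatorname{Tr}\left((A\otimes B)\rho(A\otimes B)^\dagger\right)$, where $A,B$ are invertible complex $2\times2$ matrices with $A^\dagger A\le I_2$, $B^\dagger B\le I_2$. The state $\rho$ can be quasi-purified to the singlet state if for every $\varepsilon>0$ there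 is a single copy filtering operation for which $\rho'$ is within distance $\varepsilon$ (in any fixed matrix norm) of $|\psi\rangle\langle\psi|$, where $|\psi\rangle=\frac1{\sqrt2}(|01\rangle-|10\rangle)$. *)

theory Defs
  imports "HOL-Analysis.Analysis"
begin

text \<open>The index type \<open>2\<close> has the elements \<open>0, 1\<close> and the index type \<open>4\<close> the elements
  \<open>0, 1, 2, 3\<close>. Operators on the tensor product of two qubits are indexed by pairs in \<open>2 \<times> 2\<close>;
  the pair \<open>(i, j)\<close> stands for the basis vector \<open>|ij>\<close>.\<close>

definition mscale :: "complex \<Rightarrow> complex ^ 'n ^ 'm \<Rightarrow> complex ^ 'n ^ 'm" where
  "mscale c X = (\<chi> i j. c * X $ i $ j)"

definition adjoint_mat :: "complex ^ 'n ^ 'm \<Rightarrow> complex ^ 'm ^ 'n" where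
  "adjoint_mat X = (\<chi> i j. cnj (X $ j $ i))"

definition psd :: "complex ^ 'n ^ 'n \<Rightarrow> bool" where
  "psd X \<longleftrightarrow> adjoint_mat X = X \<and>
     (\<forall>v :: complex ^ 'n. 0 \<le> Re (\<Sum>i\<in>UNIV. \<Sum>j\<in>UNIV. cnj (v $ i) * X $ i $ j * v $ j))"

definition loewner_le :: "complex ^ 'n ^ 'n \<Rightarrow> complex ^ 'n ^ 'n \<Rightarrow> bool" where
  "loewner_le X Y \<longleftrightarrow> psd (Y - X)"

definition matrix_norm :: "(complex ^ 'n ^ 'm \<Rightarrow> real) \<Rightarrow> bool" where
  "matrix_norm N \<longleftrightarrow>
     (\<forall>X. 0 \<le> N X) \<and> (\<forall>X. N X = 0 \<longleftrightarrow> X = 0) \<and>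
     (\<forall>c X. N (mscale c X) = cmod c * N X) \<and> (\<forall>X Y. N (X + Y) \<le> N X + N Y)"

definition tensor_mat ::
  "complex ^ 2 ^ 2 \<Rightarrow> complex ^ 2 ^ 2 \<Rightarrow> complex ^ (2 \<times> 2) ^ (2 \<times> 2)" where
  "tensor_mat A B = (\<chi> i j. A $ fst i $ fst j * B $ snd i $ snd j)"

definition density_matrix :: "complex ^ (2 \<times> 2) ^ (2 \<times> 2) \<Rightarrow> bool" where
  "density_matrix \<rho> \<longleftrightarrow> psd \<rho> \<and> trace \<rho> = 1"

definition mat22 :: "complex \<Rightarrow> complex \<Rightarrow> complex \<Rightarrow> complex \<Rightarrow> complex ^ 2 ^ 2" where
  "mat22 p q r s =
     (\<chi> i j. if i = 0 then (if j = 0 then p else q) else (if j = 0 then r else s))"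

definition pauli :: "4 \<Rightarrow> complex ^ 2 ^ 2" where
  "pauli k =
     (if k = 0 then mat22 1 0 0 1
      else if k = 1 then mat22 0 1 1 0
      else if k = 2 then mat22 0 (- \<i>) \<i> 0
      else mat22 1 0 0 (- 1))"

definition minkowski :: "real ^ 4 ^ 4" where
  "minkowski = (\<chi> i j. if i = j then (if i = 0 then 1 else - 1) else 0)"

definition proper_orthochronous :: "real ^ 4 ^ 4 \<Rightarrow> bool" where
  "proper_orthochronous L \<longleftrightarrow>
     L ** minkowski ** transpose L = minkowski \<and> det L = 1 \<and> L $ 0 $ 0 > 0"

definition filter_pair :: "complex ^ 2 ^ 2 \<Rightarrow> complex ^ 2 ^ 2 \<Rightarrow> bool" where
  "filter_pair A B \<longleftrightarrow>
     invertible A \<and> invertible B \<and>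
     loewner_le (adjoint_mat A ** A) (mat 1) \<and> loewner_le (adjoint_mat B ** B) (mat 1)"

definition filtered ::
  "complex ^ 2 ^ 2 \<Rightarrow> complex ^ 2 ^ 2 \<Rightarrow> complex ^ (2 \<times> 2) ^ (2 \<times> 2) \<Rightarrow>
   complex ^ (2 \<times> 2) ^ (2 \<times> 2)" where
  "filtered A B \<rho> =
     (let X = tensor_mat A B ** \<rho> ** adjoint_mat (tensor_mat A B)
      in mscale (1 / trace X) X)"

definition singlet_vec :: "complex ^ (2 \<times> 2)" where
  "singlet_vec =
     (\<chi> k. if k = (0, 1) then complex_of_real (1 / sqrt 2)
          else if k = (1, 0) then - complex_of_real (1 / sqrt 2) else 0)"

definition singlet :: "complex ^ (2 \<times> 2) ^ (2 \<times> 2)" where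
  "singlet = (\<chi> i j. singlet_vec $ i * cnj (singlet_vec $ j))"

definition quasi_purifiable ::
  "(complex ^ (2 \<times> 2) ^ (2 \<times> 2) \<Rightarrow> real) \<Rightarrow> complex ^ (2 \<times> 2) ^ (2 \<times> 2) \<Rightarrow> bool" where
  "quasi_purifiable N \<rho> \<longleftrightarrow>
     (\<forall>\<epsilon>>0. \<exists>A B. filter_pair A B \<and> N (filtered A B \<rho> - singlet) < \<epsilon>)"

definition Sigma_form :: "real \<Rightarrow> real \<Rightarrow> real \<Rightarrow> real \<Rightarrow> real ^ 4 ^ 4" where
  "Sigma_form a b c d =
     (\<chi> i j.
        if i = 0 \<and> j = 0 then a else if i = 0 \<and> j = 3 then b
        else if i = 1 \<and> j = 1 then d else if i = 2 \<and> j = 2 then - d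
        else if i = 3 \<and> j = 0 then c else if i = 3 \<and> j = 3 then a + c - b
        else 0)"

end

theory Submission
  imports Defs
begin

text \<open>Let \<open>S = \<sigma>\<^sub>2 \<otimes> \<sigma>\<^sub>2\<close> and \<open>D = \<rho> S cnj(\<rho>) S\<close>. Filtering multiplies \<open>tr D\<close> and \<open>tr D\<^sup>2\<close> by some
  \<open>\<kappa>\<close> and \<open>\<kappa>\<^sup>2\<close>, so \<open>tr D\<^sup>2 = (tr D)\<^sup>2 \<noteq> 0\<close>, which holds for the singlet, holds for every
  quasi-purifiable state. Write \<open>\<rho> = Y Y*\<close> and view the columns of \<open>Y\<close> as \<open>2 \<times> 2\<close> matrices. Then
  \<open>(tr D)\<^sup>2 - tr D\<^sup>2\<close> is half the sum of the squared moduli of the \<open>2 \<times> 2\<close> minors of the Gram matrix of the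
  columns under the polar form of the determinant, so this Gram matrix has rank one. Hence \<open>\<rho>\<close> is
  supported on one invertible matrix \<open>V\<close> and a totally isotropic space orthogonal to \<open>V\<close>; after
  multiplication by \<open>V\<inverse>\<close> that space is traceless and therefore spanned by one nilpotent. So unimodular
  local maps bring \<open>\<rho>\<close> to \<open>p |\<Phi>><\<Phi>| + q |10><10|\<close>, whose correlation matrix is the one in the
  theorem. Conversely, the spinor map \<open>SL(2,\<complex>) \<rightarrow> SO\<^sup>+(1,3)\<close> is onto, so the two Lorentz transformations lift to
  such local maps, and filtering the normal form by \<open>diag(1,t) \<otimes> diag(t,1)\<close> with \<open>t \<rightarrow> 0\<close> suppresses
  the product term.\<close>

section \<open>Matrices of size two and their tensor products\<close>

lemma exhaust_bit: "(i :: 2) = 0 \<or> i = 1"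
  using exhaust_2[of i] by auto

lemma UNIV_bit: "(UNIV :: 2 set) = {0, 1}"
  using exhaust_bit by auto

lemma forall_bit: "(\<forall>i :: 2. P i) \<longleftrightarrow> P 0 \<and> P 1"
  by (metis exhaust_bit)

lemma sum_bit: "(\<Sum>i\<in>(UNIV :: 2 set). f i) = f 0 + f 1"
  by (simp add: UNIV_bit)

lemma exhaust_four: "(i :: 4) = 0 \<or> i = 1 \<or> i = 2 \<or> i = 3"
  using exhaust_4[of i] by auto

lemma UNIV_four: "(UNIV :: 4 set) = {0, 1, 2, 3}"
  using exhaust_four by auto

lemma forall_four: "(\<forall>i :: 4. P i) \<longleftrightarrow> P 0 \<and> P 1 \<and> P 2 \<and> P 3"
  by (metis exhaust_four)

lemma sum_four: "(\<Sum>i\<in>(UNIV :: 4 set). f i) = f 0 + f 1 + f 2 + f 3"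
proof -
  \<comment> \<open>Arithmetic in the index type is modulo 4, so the library enumeration 1, 2, 3, 4
    ends with the time index 0.\<close>
  have "(4 :: 4) = 0" by simp
  then have "sum f UNIV = (f 1 + f 2 + f 3) + f 0"
    unfolding sum_4 by (simp only:)
  then show ?thesis by (simp only: add.commute[of _ "f 0"] add.assoc)
qed

lemma sum_bits: "(\<Sum>k\<in>(UNIV :: (2 \<times> 2) set). f k) = (\<Sum>i\<in>UNIV. \<Sum>j\<in>UNIV. f (i, j))"
  unfolding UNIV_Times_UNIV[symmetric] by (simp add: sum.cartesian_product)

lemma forall_bits: "(\<forall>k :: 2 \<times> 2. P k) \<longleftrightarrow> P (0, 0) \<and> P (0, 1) \<and> P (1, 0) \<and> P (1, 1)"
  by (simp add: split_paired_all[symmetric] split_paired_All forall_bit)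

lemma mat22_nth [simp]:
  "mat22 p q r s $ 0 $ 0 = p" "mat22 p q r s $ 0 $ 1 = q"
  "mat22 p q r s $ 1 $ 0 = r" "mat22 p q r s $ 1 $ 1 = s"
  by (simp_all add: mat22_def)

lemma mat22_expand: "A = mat22 (A $ 0 $ 0) (A $ 0 $ 1) (A $ 1 $ 0) (A $ 1 $ 1)"
  by (simp add: vec_eq_iff forall_bit)

lemma mat22_cases: obtains p q r s where "A = mat22 p q r s"
  using mat22_expand by blast

lemma mat22_eq_iff [simp]:
  "mat22 p q r s = mat22 p' q' r' s' \<longleftrightarrow> p = p' \<and> q = q' \<and> r = r' \<and> s = s'"
  by (auto simp: vec_eq_iff forall_bit)

lemma mat22_mult [simp]:
  "mat22 p q r s ** mat22 p' q' r' s' =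
     mat22 (p * p' + q * r') (p * q' + q * s') (r * p' + s * r') (r * q' + s * s')"
  by (simp add: vec_eq_iff forall_bit matrix_matrix_mult_def sum_bit)

lemma mat22_add [simp]:
  "mat22 p q r s + mat22 p' q' r' s' = mat22 (p + p') (q + q') (r + r') (s + s')"
  by (simp add: vec_eq_iff forall_bit)

lemma mscale_mat22 [simp]: "mscale c (mat22 p q r s) = mat22 (c * p) (c * q) (c * r) (c * s)"
  by (simp add: vec_eq_iff forall_bit mscale_def)

lemma adjoint_mat22 [simp]:
  "adjoint_mat (mat22 p q r s) = mat22 (cnj p) (cnj r) (cnj q) (cnj s)"
  by (simp add: vec_eq_iff forall_bit adjoint_mat_def)

lemma transpose_mat22 [simp]: "transpose (mat22 p q r s) = mat22 p r q s"
  by (simp add: vec_eq_iff forall_bit transpose_def)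

lemma mat_1_mat22: "mat 1 = mat22 1 0 0 1"
  by (simp add: vec_eq_iff forall_bit mat_def)

lemma trace_mat22 [simp]: "trace (mat22 p q r s) = p + s"
  by (simp add: trace_def sum_bit)

lemma det_mat22 [simp]: "det (mat22 p q r s) = p * s - q * r"
proof -
  have "(2 :: 2) = 0" by simp
  then show ?thesis unfolding det_2 by (simp only: mat22_nth) (simp add: mult.commute)
qed

lemma pauli_simps [simp]:
  "pauli 0 = mat22 1 0 0 1" "pauli 1 = mat22 0 1 1 0"
  "pauli 2 = mat22 0 (- \<i>) \<i> 0" "pauli 3 = mat22 1 0 0 (- 1)"
  by (simp_all add: pauli_def)

lemma adjoint_mult: "adjoint_mat (X ** Y) = adjoint_mat Y ** adjoint_mat X"
  by (simp add: vec_eq_iff adjoint_mat_def matrix_matrix_mult_def mult.commute)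

lemma adjoint_mat_adjoint [simp]: "adjoint_mat (adjoint_mat X) = X"
  by (simp add: vec_eq_iff adjoint_mat_def)

lemma adjoint_mscale: "adjoint_mat (mscale c X) = mscale (cnj c) (adjoint_mat X)"
  by (simp add: vec_eq_iff adjoint_mat_def mscale_def)

lemma mscale_mult_left: "mscale c X ** Y = mscale c (X ** Y)"
  by (simp add: vec_eq_iff mscale_def matrix_matrix_mult_def sum_distrib_left mult.assoc)

lemma mscale_mult_right: "X ** mscale c Y = mscale c (X ** Y)"
  by (simp add: vec_eq_iff mscale_def matrix_matrix_mult_def sum_distrib_left mult_ac)

lemma mscale_mscale [simp]: "mscale c (mscale d X) = mscale (c * d) X"
  by (simp add: vec_eq_iff mscale_def mult.assoc)

lemma mscale_1 [simp]: "mscale 1 X = X"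
  by (simp add: vec_eq_iff mscale_def)

lemma trace_mscale: "trace (mscale c X) = c * trace X"
  by (simp add: trace_def mscale_def sum_distrib_left)

lemma tensor_mult: "tensor_mat A B ** tensor_mat C D = tensor_mat (A ** C) (B ** D)"
  by (simp add: vec_eq_iff tensor_mat_def matrix_matrix_mult_def sum_bits sum_bit algebra_simps)

lemma adjoint_tensor: "adjoint_mat (tensor_mat A B) = tensor_mat (adjoint_mat A) (adjoint_mat B)"
  by (simp add: vec_eq_iff tensor_mat_def adjoint_mat_def)

lemma tensor_mscale: "tensor_mat (mscale c A) (mscale d B) = mscale (c * d) (tensor_mat A B)"
  by (simp add: vec_eq_iff tensor_mat_def mscale_def mult_ac)

section \<open>The spinor map\<close>

text \<open>The identification of Minkowski space with Hermitian 2 x 2 matrices, in which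
  \<open>x\<close> holds the Pauli coordinates. The determinant becomes the Minkowski square of
  \<open>x\<close>.\<close>

definition hermitian :: "real ^ 4 \<Rightarrow> complex ^ 2 ^ 2" where
  "hermitian x = mat22 (of_real (x $ 0 + x $ 3)) (Complex (x $ 1) (- x $ 2))
                       (Complex (x $ 1) (x $ 2)) (of_real (x $ 0 - x $ 3))"

lemma hermitian_inject [simp]: "hermitian x = hermitian y \<longleftrightarrow> x = y"
proof -
  have "x = y \<longleftrightarrow> x $ 0 = y $ 0 \<and> x $ 1 = y $ 1 \<and> x $ 2 = y $ 2 \<and> x $ 3 = y $ 3"
    by (simp add: vec_eq_iff forall_four)
  then show ?thesis
    unfolding hermitian_def mat22_eq_iff by (auto simp: complex_eq_iff)
qed

lemma hermitian_pauli: "hermitian x = (\<Sum>k\<in>UNIV. mscale (of_real (x $ k)) (pauli k))"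
  by (simp add: hermitian_def sum_four complex_eq_iff)

text \<open>The Pauli matrices are orthogonal for the trace form, each with square norm 2, so half
  the traces are the coordinates.\<close>

lemma hermitian_coeffs:
  assumes "adjoint_mat H = H"
  shows "H = hermitian (\<chi> k. Re (trace (pauli k ** H)) / 2)"
proof -
  obtain p q r s where H: "H = mat22 p q r s" by (rule mat22_cases)
  have "cnj p = p" "cnj r = q" "cnj s = s" using assms unfolding H by auto
  then show ?thesis by (auto simp: H hermitian_def complex_eq_iff field_simps)
qed

lemma adjoint_pauli [simp]: "adjoint_mat (pauli k) = pauli k"
  using exhaust_four[of k] by auto

lemma adjoint_hermitian [simp]: "adjoint_mat (hermitian x) = hermitian x"
  by (simp add: hermitian_def complex_eq_iff)

lemma matrix_add_rdistrib: "(A + B) ** C = A ** C + B ** C" for A B :: "'a::semiring_1 ^ 'n ^ 'm"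
  by (vector matrix_matrix_mult_def sum.distrib[symmetric] distrib_right)

lemma trace_mult_sum_mult:
  fixes X Y :: "complex ^ 'n ^ 'n" and Z :: "4 \<Rightarrow> complex ^ 'n ^ 'n"
  shows "trace (X ** (\<Sum>k\<in>UNIV. mscale (c k) (Z k)) ** Y) = (\<Sum>k\<in>UNIV. c k * trace (X ** Z k ** Y))"
  by (simp add: sum_four matrix_add_ldistrib matrix_add_rdistrib trace_add
      mscale_mult_left mscale_mult_right trace_mscale)

text \<open>The matrix, in Pauli coordinates, of conjugation of Hermitian matrices by
  \<open>A\<close>. It makes sense for every \<open>A\<close>; it is a Lorentz transformation once
  \<open>det A = 1\<close>.\<close>

definition spinor_map :: "complex ^ 2 ^ 2 \<Rightarrow> real ^ 4 ^ 4" where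
  "spinor_map A = (\<chi> i k. Re (trace (pauli i ** A ** pauli k ** adjoint_mat A)) / 2)"

lemma hermitian_spinor_map: "A ** hermitian x ** adjoint_mat A = hermitian (spinor_map A *v x)"
proof -
  have "A ** hermitian x ** adjoint_mat A =
      hermitian (\<chi> i. Re (trace (pauli i ** (A ** hermitian x ** adjoint_mat A))) / 2)"
    by (rule hermitian_coeffs) (simp add: adjoint_mult matrix_mul_assoc)
  also have "(\<chi> i. Re (trace (pauli i ** (A ** hermitian x ** adjoint_mat A))) / 2) = spinor_map A *v x"
  proof -
    have "trace (pauli i ** (A ** hermitian x ** adjoint_mat A)) =
      (\<Sum>k\<in>UNIV. of_real (x $ k) * trace (pauli i ** A ** pauli k ** adjoint_mat A))" for i
      unfolding hermitian_pauli trace_mult_sum_mult[symmetric] by (simp add: matrix_mul_assoc)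
    then show ?thesis
      by (simp add: vec_eq_iff spinor_map_def matrix_vector_mult_def sum_divide_distrib mult.commute)
  qed
  finally show ?thesis .
qed

text \<open>The same conjugation moved from the state to the observable: by cyclicity of the trace,
  the i-th row of \<open>spinor_map A\<close> gives the Pauli coordinates. This is the form needed
  to transform correlation matrices.\<close>

lemma adjoint_pauli_conj:
  "adjoint_mat A ** pauli i ** A = (\<Sum>k\<in>UNIV. mscale (of_real (spinor_map A $ i $ k)) (pauli k))"
proof -
  have "adjoint_mat A ** pauli i ** A = hermitian (\<chi> k. Re (trace (pauli k ** (adjoint_mat A ** pauli i ** A))) / 2)"
    by (rule hermitian_coeffs) (simp add: adjoint_mult matrix_mul_assoc)
  moreover have "trace (pauli k ** (adjoint_mat A ** pauli i ** A)) = trace (pauli i ** A ** pauli k ** adjoint_mat A)" for k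
    using trace_mul_sym[of "pauli k ** adjoint_mat A" "pauli i ** A"] by (simp add: matrix_mul_assoc)
  ultimately show ?thesis by (simp add: hermitian_pauli spinor_map_def)
qed

lemma spinor_map_eqI:
  assumes "\<And>x. A ** hermitian x ** adjoint_mat A = hermitian (L *v x)"
  shows "spinor_map A = L"
  unfolding matrix_eq using assms by (simp add: hermitian_spinor_map)

lemma spinor_map_mult: "spinor_map (A ** B) = spinor_map A ** spinor_map B"
proof (rule spinor_map_eqI)
  fix x
  have "A ** B ** hermitian x ** adjoint_mat (A ** B) =
      A ** (B ** hermitian x ** adjoint_mat B) ** adjoint_mat A"
    by (simp add: adjoint_mult matrix_mul_assoc)
  then show "A ** B ** hermitian x ** adjoint_mat (A ** B) =
      hermitian (spinor_map A ** spinor_map B *v x)"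
    by (simp add: hermitian_spinor_map matrix_vector_mul_assoc)
qed

lemma transpose_spinor_map: "transpose (spinor_map A) = spinor_map (adjoint_mat A)"
proof -
  have "trace (pauli k ** A ** pauli i ** adjoint_mat A) = trace (pauli i ** adjoint_mat A ** pauli k ** A)" for i k
    using trace_mul_sym[of "pauli k ** A" "pauli i ** adjoint_mat A"] by (simp add: matrix_mul_assoc)
  then show ?thesis by (simp add: vec_eq_iff transpose_def spinor_map_def)
qed

lemma spinor_map_1: "spinor_map (mat 1) = mat 1"
  by (rule spinor_map_eqI) (simp add: mat_1_mat22 hermitian_def)

section \<open>Surjectivity of the spinor map\<close>

lemma minkowski_mult_self: "minkowski ** minkowski = mat 1"
  by (simp add: vec_eq_iff forall_four minkowski_def matrix_matrix_mult_def sum_four mat_def)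

lemma minkowski_inner:
  "x \<bullet> (minkowski *v y) = x $ 0 * y $ 0 - x $ 1 * y $ 1 - x $ 2 * y $ 2 - x $ 3 * y $ 3"
  by (simp add: inner_vec_def sum_four minkowski_def matrix_vector_mult_def)

lemma det_hermitian: "det (hermitian x) = of_real (x \<bullet> (minkowski *v x))"
  by (simp add: hermitian_def minkowski_inner complex_eq_iff algebra_simps)

lemma det_adjoint_22: "det (adjoint_mat A) = cnj (det A)" for A :: "complex ^ 2 ^ 2"
  by (rule mat22_cases[of A]) simp

lemma det_mscale_22: "det (mscale c A) = c\<^sup>2 * det A" for A :: "complex ^ 2 ^ 2"
  by (rule mat22_cases[of A]) (simp add: power2_eq_square algebra_simps)

text \<open>The hypothesis exhibits a right inverse of \<open>L\<close>; for square matrices it is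
  also a left inverse.\<close>

lemma lorentz_transpose:
  assumes "L ** minkowski ** transpose L = minkowski"
  shows "transpose L ** minkowski ** L = minkowski"
proof -
  have "L ** (minkowski ** transpose L ** minkowski) = mat 1"
    using assms by (simp add: matrix_mul_assoc minkowski_mult_self)
  then have "minkowski ** transpose L ** minkowski ** L = mat 1"
    by (simp add: matrix_left_right_inverse)
  then have "minkowski ** (minkowski ** transpose L ** minkowski ** L) = minkowski"
    by simp
  then show ?thesis
    by (simp add: matrix_mul_assoc minkowski_mult_self)
qed

lemma inner_matrix_vector_transpose: "(A *v x) \<bullet> y = x \<bullet> (transpose A *v y)"
  for A :: "real ^ 'n ^ 'm"
  by (metis dot_lmul_matrix inner_commute transpose_matrix_vector)

lemma lorentz_columns:
  assumes "L ** minkowski ** transpose L = minkowski"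
  shows "(L *v axis i 1) \<bullet> (minkowski *v (L *v axis j 1)) = minkowski $ i $ j"
proof -
  have "(L *v axis i 1) \<bullet> (minkowski *v (L *v axis j 1))
      = axis i 1 \<bullet> ((transpose L ** minkowski ** L) *v axis j 1)"
    by (simp add: inner_matrix_vector_transpose matrix_vector_mul_assoc matrix_mul_assoc)
  also have "\<dots> = minkowski $ i $ j"
    by (simp add: lorentz_transpose[OF assms] inner_axis' matrix_vector_mult_basis column_def)
  finally show ?thesis .
qed

text \<open>Polarization: the values of the form at the axes kill the diagonal, and the value at the
  sum of two axes is then twice an off-diagonal entry.\<close>

lemma symmetric_eq_0I:
  fixes K :: "real ^ 'n ^ 'n"
  assumes sym: "transpose K = K" and zero: "\<And>x. x \<bullet> (K *v x) = 0"
  shows "K = 0"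
proof -
  have K: "axis i 1 \<bullet> (K *v axis j 1) = K $ i $ j" for i j
    by (simp add: inner_axis' matrix_vector_mult_basis column_def)
  have "K $ i $ j = 0" for i j
  proof -
    have "K $ i $ j = K $ j $ i"
      using arg_cong[OF sym, of "\<lambda>X. X $ i $ j"] by (simp add: transpose_def)
    moreover have "K $ i $ i = 0" "K $ j $ j = 0" using zero[of "axis _ 1"] K by simp_all
    ultimately show ?thesis
      using zero[of "axis i 1 + axis j 1"] K
      by (simp add: matrix_vector_right_distrib inner_add_left inner_add_right)
  qed
  then show ?thesis by (simp add: vec_eq_iff)
qed

lemma transpose_difference: "transpose (A - B) = transpose A - transpose B"
  by (simp add: vec_eq_iff transpose_def)

text \<open>Conjugation by a unimodular matrix preserves the determinant, that is, the Minkowski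
  square. The argument runs through the adjoint of \<open>A\<close>, whose image is the transpose,
  because invariance of the quadratic form gives the identity with the transpose on the
  left.\<close>

lemma lorentz_spinor_map:
  assumes "det A = 1"
  shows "spinor_map A ** minkowski ** transpose (spinor_map A) = minkowski"
proof -
  let ?L = "spinor_map (adjoint_mat A)"
  have "det (adjoint_mat A) = 1" using assms by (simp add: det_adjoint_22)
  then have "(?L *v x) \<bullet> (minkowski *v (?L *v x)) = x \<bullet> (minkowski *v x)" for x
    using arg_cong[OF hermitian_spinor_map[of "adjoint_mat A" x], of det] assms
    by (simp add: det_hermitian det_mul)
  then have "x \<bullet> ((transpose ?L ** minkowski ** ?L - minkowski) *v x) = 0" for x
    by (simp add: matrix_vector_mult_diff_rdistrib inner_diff_right inner_matrix_vector_transpose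
        matrix_vector_mul_assoc matrix_mul_assoc)
  moreover have "transpose minkowski = minkowski"
    by (auto simp: vec_eq_iff transpose_def minkowski_def)
  then have "transpose (transpose ?L ** minkowski ** ?L - minkowski)
      = transpose ?L ** minkowski ** ?L - minkowski"
    by (simp add: transpose_difference matrix_transpose_mul matrix_mul_assoc)
  ultimately have "transpose ?L ** minkowski ** ?L - minkowski = 0"
    by (rule symmetric_eq_0I[rotated])
  then show ?thesis by (simp add: transpose_spinor_map)
qed

lemma det_lorentz_square:
  assumes "L ** minkowski ** transpose L = minkowski"
  shows "det L * det L = 1"
proof -
  have "det minkowski * det minkowski = 1"
    by (metis minkowski_mult_self det_mul det_I)
  then have "det minkowski \<noteq> 0" by auto
  moreover have "det L * det minkowski * det L = det minkowski"
    by (metis assms det_mul det_transpose)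
  ultimately show ?thesis by simp
qed

lemma spinor_map_uminus: "spinor_map (- A) = spinor_map A"
proof (rule spinor_map_eqI)
  show "- A ** hermitian x ** adjoint_mat (- A) = hermitian (spinor_map A *v x)" for x
    unfolding hermitian_spinor_map[symmetric]
    by (simp add: vec_eq_iff matrix_matrix_mult_def adjoint_mat_def sum_negf)
qed

text \<open>By Cayley-Hamilton, \<open>B = (A + 1) / sqrt (tr A + 2)\<close> is a square root of \<open>A\<close> unless \<open>tr A = - 2\<close>;
  in that case \<open>- A\<close>, which has the same image under the spinor map, has a root.\<close>

lemma unimodular_square:
  fixes A :: "complex ^ 2 ^ 2"
  assumes "det A = 1"
  obtains B where "det B = 1" "B ** B = A \<or> B ** B = - A"
proof -
  have *: "\<exists>B. det B = 1 \<and> B ** B = A" if "det A = 1" "trace A \<noteq> - 2" for A :: "complex ^ 2 ^ 2"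
  proof -
    obtain p q r s where A: "A = mat22 p q r s" by (rule mat22_cases)
    define k where "k = csqrt (p + s + 2)"
    have d: "p * s - q * r = 1" and k: "k\<^sup>2 = p + s + 2" "k \<noteq> 0"
      using that by (auto simp: A k_def add_eq_0_iff2)
    have "k * k \<noteq> 0" "k * k = p + s + 2" using k by (auto simp: power2_eq_square)
    moreover from d have d': "q * r = p * s - 1" by (simp add: algebra_simps)
    ultimately have "det (mscale (1 / k) (A + mat 1)) = 1"
      "mscale (1 / k) (A + mat 1) ** mscale (1 / k) (A + mat 1) = A"
      by (simp_all add: A mat_1_mat22 divide_simps) (simp_all add: algebra_simps)
    then show ?thesis by blast
  qed
  show thesis
  proof (cases "trace A = - 2")
    case False
    then show thesis using * assms that by blast
  next
    case True
    have "det (- A) = 1" "trace (- A) = 2"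
      using assms True det_mscale_22[of "- 1" A] trace_mscale[of "- 1" A]
      by (simp_all add: mscale_def uminus_vec_def vec_lambda_eta)
    then show thesis using *[of "- A"] that by auto
  qed
qed

text \<open>A Lorentz matrix has determinant 1 or -1, and up to a sign that the spinor map ignores
  \<open>A\<close> is a square. So its image is the square of a Lorentz matrix, which replaces a
  connectedness argument.\<close>

lemma det_spinor_map:
  assumes "det A = 1"
  shows "det (spinor_map A) = 1"
proof -
  obtain B where B: "det B = 1" "B ** B = A \<or> B ** B = - A"
    using unimodular_square[OF assms] .
  then have "spinor_map A = spinor_map B ** spinor_map B"
    by (metis spinor_map_mult spinor_map_uminus)
  then show ?thesis
    by (simp add: det_mul det_lorentz_square[OF lorentz_spinor_map[OF B(1)]])
qed

text \<open>The time-time entry is half the sum of the squared moduli of the entries of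
  \<open>A\<close>.\<close>

lemma proper_orthochronous_spinor_map:
  assumes "det A = 1"
  shows "proper_orthochronous (spinor_map A)"
proof -
  obtain p q r s where A: "A = mat22 p q r s" by (rule mat22_cases)
  have "spinor_map A $ 0 $ 0 = ((cmod p)\<^sup>2 + (cmod q)\<^sup>2 + (cmod r)\<^sup>2 + (cmod s)\<^sup>2) / 2"
    by (simp add: spinor_map_def A cmod_power2) (simp add: power2_eq_square)
  moreover have "p \<noteq> 0 \<or> q \<noteq> 0" using assms by (auto simp: A)
  then have "(cmod p)\<^sup>2 + (cmod q)\<^sup>2 > 0" by (simp add: sum_power2_gt_zero_iff)
  ultimately have "spinor_map A $ 0 $ 0 > 0"
    by (smt (verit) divide_pos_pos zero_le_power2)
  then show ?thesis
    by (simp add: proper_orthochronous_def lorentz_spinor_map det_spinor_map assms)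
qed

section \<open>Boosts and rotations as images of explicit unimodular matrices\<close>

lemma hermitian_axis_0: "hermitian (axis 0 1) = mat 1"
  by (simp add: hermitian_def mat_1_mat22 axis_def complex_eq_iff)

text \<open>The witness is the Hermitian square root of \<open>hermitian x\<close>. This matrix has
  determinant 1 and trace \<open>2 * x $ 0\<close>, so by Cayley-Hamilton the root is the matrix
  plus the identity, divided by the square root of the trace plus 2. Conjugating the identity by the
  root squares it.\<close>

lemma boost_exists:
  assumes "x \<bullet> (minkowski *v x) = 1" "x $ 0 > 0"
  shows "\<exists>A. det A = 1 \<and> spinor_map A *v axis 0 1 = x"
proof -
  define k where "k = sqrt (2 * x $ 0 + 2)"
  have k: "k * k = 2 * x $ 0 + 2" "k \<noteq> 0" using assms(2) by (auto simp: k_def)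
  define A where "A = mscale (of_real (1 / k)) (hermitian (x + axis 0 1))"
  have x: "x $ 1 * x $ 1 = x $ 0 * x $ 0 - x $ 2 * x $ 2 - x $ 3 * x $ 3 - 1"
    using assms(1) by (simp add: minkowski_inner)
  have "det A = of_real (1 / (k * k)) * of_real ((x + axis 0 1) \<bullet> (minkowski *v (x + axis 0 1)))"
    by (simp add: A_def det_mscale_22 det_hermitian power2_eq_square)
  also have "(x + axis 0 1) \<bullet> (minkowski *v (x + axis 0 1)) = k * k"
    using assms(1) by (simp add: k minkowski_inner axis_def algebra_simps)
  also have "complex_of_real (1 / (k * k)) * of_real (k * k) = 1" using k(2) by (simp flip: of_real_mult)
  finally have "det A = 1" .
  moreover have "A ** hermitian (axis 0 1) ** adjoint_mat A = hermitian x"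
  proof -
    have "A ** hermitian (axis 0 1) ** adjoint_mat A =
       mscale (of_real (1 / (k * k))) (hermitian (x + axis 0 1) ** hermitian (x + axis 0 1))"
      by (simp add: A_def hermitian_axis_0 adjoint_mscale mscale_mult_left mscale_mult_right)
    also have "hermitian (x + axis 0 1) ** hermitian (x + axis 0 1) = mscale (of_real (k * k)) (hermitian x)"
      using x unfolding k by (simp add: hermitian_def axis_def complex_eq_iff algebra_simps)
    finally show ?thesis using k(2) by (simp flip: of_real_mult)
  qed
  ultimately show ?thesis by (auto simp: hermitian_spinor_map)
qed

text \<open>The rotation carries the third axis to \<open>y\<close>. Its lift is the unitary
  proportional to \<open>W\<close>, which is the identity plus the product of
  \<open>hermitian y\<close> with the third Pauli matrix. At the antipode of the third axis
  \<open>W\<close> vanishes, and the half turn about the first axis is used instead.\<close>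

lemma rotation_exists:
  assumes "y $ 0 = 0" "y \<bullet> (minkowski *v y) = - 1"
  shows "\<exists>U. det U = 1 \<and> spinor_map U *v axis 0 1 = axis 0 1 \<and> spinor_map U *v axis 3 1 = y"
proof (cases "y $ 3 = - 1")
  case True
  then have "y $ 1 * y $ 1 + y $ 2 * y $ 2 = 0"
    using assms(2) by (simp add: minkowski_inner assms(1) del: sum_squares_eq_zero_iff)
  then have "y $ 1 = 0" "y $ 2 = 0"
    by simp_all
  then have "mat22 0 \<i> \<i> 0 ** hermitian (axis 0 1) ** adjoint_mat (mat22 0 \<i> \<i> 0) = hermitian (axis 0 1)"
    "mat22 0 \<i> \<i> 0 ** hermitian (axis 3 1) ** adjoint_mat (mat22 0 \<i> \<i> 0) = hermitian y"
    using True assms(1) by (simp_all add: hermitian_def axis_def complex_eq_iff)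
  then show ?thesis
    by (intro exI[of _ "mat22 0 \<i> \<i> 0"]) (simp only: hermitian_spinor_map hermitian_inject, simp)
next
  case False
  have y: "y $ 1 * y $ 1 = 1 - y $ 2 * y $ 2 - y $ 3 * y $ 3"
    using assms by (simp add: minkowski_inner)
  then have "y $ 3 * y $ 3 \<le> 1" by (smt (verit) zero_le_square)
  then have "y $ 3 > - 1" using False by (smt (verit) mult_less_cancel_left1 square_le_1 power2_eq_square mult_minus_left mult_minus_right)
  define k where "k = sqrt (2 + 2 * y $ 3)"
  have k: "k * k = 2 + 2 * y $ 3" "k \<noteq> 0" using \<open>y $ 3 > - 1\<close> by (auto simp: k_def)
  define W where "W = mat22 (of_real (1 + y $ 3)) (Complex (- y $ 1) (y $ 2)) (Complex (y $ 1) (y $ 2)) (of_real (1 + y $ 3))"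
  define U where "U = mscale (of_real (1 / k)) W"
  have scale: "mscale (of_real (1 / (k * k))) (mscale (of_real (k * k)) X) = X" for X :: "complex ^ 2 ^ 2"
    using k(2) by (simp flip: of_real_mult)
  have U: "U ** H ** adjoint_mat U = mscale (of_real (1 / (k * k))) (W ** H ** adjoint_mat W)" for H
    by (simp add: U_def adjoint_mscale mscale_mult_left mscale_mult_right)
  have "det W = of_real (k * k)"
    using y unfolding k by (simp add: W_def complex_eq_iff algebra_simps)
  then have "det U = 1"
    using k(2) by (simp add: U_def det_mscale_22 power2_eq_square)
  moreover have "W ** hermitian (axis 0 1) ** adjoint_mat W = mscale (of_real (k * k)) (hermitian (axis 0 1))"
    using y unfolding k by (simp add: W_def hermitian_def axis_def complex_eq_iff algebra_simps)
  then have "U ** hermitian (axis 0 1) ** adjoint_mat U = hermitian (axis 0 1)"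
    by (simp only: U scale)
  moreover have "W ** hermitian (axis 3 1) ** adjoint_mat W = mscale (of_real (k * k)) (hermitian y)"
    using y assms(1) unfolding k by (simp add: W_def hermitian_def axis_def complex_eq_iff algebra_simps)
  then have "U ** hermitian (axis 3 1) ** adjoint_mat U = hermitian y"
    by (simp only: U scale)
  ultimately show ?thesis by (intro exI[of _ U]) (simp add: hermitian_spinor_map)
qed

text \<open>A rotation about the third axis lifts to a diagonal matrix of opposite phases. The angle
  is halved because conjugation applies the phases on both sides.\<close>

lemma axial_rotation_exists:
  assumes "z $ 0 = 0" "z $ 3 = 0" "z \<bullet> (minkowski *v z) = - 1"
  shows "\<exists>U. det U = 1 \<and> spinor_map U *v axis 0 1 = axis 0 1 \<and>
    spinor_map U *v axis 3 1 = axis 3 1 \<and> spinor_map U *v axis 1 1 = z"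
proof -
  have "(z $ 1)\<^sup>2 + (z $ 2)\<^sup>2 = 1" using assms by (simp add: minkowski_inner power2_eq_square)
  then obtain t where t: "z $ 1 = cos t" "z $ 2 = sin t" using sincos_total_2pi by metis
  define U where "U = mat22 (cis (- t / 2)) 0 0 (cis (t / 2))"
  have "det U = 1" by (simp add: U_def cis_mult)
  moreover have "U ** hermitian (axis 0 1) ** adjoint_mat U = hermitian (axis 0 1)"
    "U ** hermitian (axis 3 1) ** adjoint_mat U = hermitian (axis 3 1)"
    "U ** hermitian (axis 1 1) ** adjoint_mat U = hermitian z"
    using assms t by (simp_all add: U_def hermitian_def axis_def cis_cnj cis_mult flip: complex_of_real_def) (simp_all add: complex_eq_iff)
  ultimately show ?thesis by (auto simp: hermitian_spinor_map)
qed

lemma unimodular_inverse: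
  fixes A :: "complex ^ 2 ^ 2"
  assumes "det A = 1"
  obtains B where "det B = 1" "A ** B = mat 1" "B ** A = mat 1"
proof -
  obtain p q r s where A: "A = mat22 p q r s" by (rule mat22_cases)
  show thesis
    by (rule that[of "mat22 s (- q) (- r) p"]) (use assms in \<open>simp_all add: A mat_1_mat22 algebra_simps\<close>)
qed

text \<open>One step of the factorization: if \<open>spinor_map A\<close> already does to
  \<open>x\<close> what \<open>L\<close> does to \<open>y\<close>, the remaining factor sends
  \<open>y\<close> to \<open>x\<close>. With \<open>x = y\<close> an axis, the remaining factor
  fixes that axis.\<close>

lemma lorentz_peel:
  assumes L: "L ** minkowski ** transpose L = minkowski" "det L = 1" and A: "det A = 1"
  obtains L' where "L' ** minkowski ** transpose L' = minkowski" "det L' = 1"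
    "L = spinor_map A ** L'"
    "\<And>x y. spinor_map A *v x = L *v y \<Longrightarrow> L' *v y = x"
proof -
  obtain B where B: "det B = 1" "A ** B = mat 1" "B ** A = mat 1"
    using unimodular_inverse[OF A] .
  have inv: "spinor_map A ** spinor_map B = mat 1" "spinor_map B ** spinor_map A = mat 1"
    by (simp_all add: B spinor_map_1 flip: spinor_map_mult)
  show thesis
  proof (rule that[of "spinor_map B ** L"])
    have "spinor_map B ** (L ** minkowski ** transpose L) ** transpose (spinor_map B) = minkowski"
      by (simp add: L lorentz_spinor_map B)
    then show "spinor_map B ** L ** minkowski ** transpose (spinor_map B ** L) = minkowski"
      by (simp add: matrix_transpose_mul matrix_mul_assoc)
    show "det (spinor_map B ** L) = 1" by (simp add: det_mul det_spinor_map B L)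
    show "L = spinor_map A ** (spinor_map B ** L)" by (simp add: matrix_mul_assoc inv)
    show "spinor_map B ** L *v y = x" if "spinor_map A *v x = L *v y" for x y
      by (simp add: inv matrix_vector_mul_assoc[symmetric] flip: that) (simp add: inv matrix_vector_mul_assoc)
  qed
qed

text \<open>The image of the remaining axis is Minkowski-orthogonal to the three fixed axes, hence a
  multiple of that axis; the determinant makes the multiple 1.\<close>

lemma lorentz_fixing_three_axes:
  assumes L: "L ** minkowski ** transpose L = minkowski" "det L = 1"
    and fixed: "L *v axis 0 1 = axis 0 1" "L *v axis 1 1 = axis 1 1" "L *v axis 3 1 = axis 3 1"
  shows "L = mat 1"
proof -
  have w: "(L *v axis 2 1) $ 0 = 0" "(L *v axis 2 1) $ 1 = 0" "(L *v axis 2 1) $ 3 = 0"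
    using lorentz_columns[OF L(1), of 0 2] lorentz_columns[OF L(1), of 1 2] lorentz_columns[OF L(1), of 3 2]
    by (simp_all add: fixed minkowski_inner) (simp_all add: axis_def minkowski_def)
  have col: "(L *v axis j 1) $ i = L $ i $ j" for i j
    by (simp add: matrix_vector_mult_basis column_def)
  have e: "L $ i $ 0 = (if i = 0 then 1 else 0)" "L $ i $ 1 = (if i = 1 then 1 else 0)"
    "L $ i $ 3 = (if i = 3 then 1 else 0)" for i
    using fixed by (simp_all flip: col) (simp_all add: axis_def)
  have "L $ i $ j = 0" if "i \<noteq> j" for i j
    using that exhaust_four[of j] exhaust_four[of i] e w[unfolded col] by metis
  then have "det L = (\<Prod>i\<in>UNIV. L $ i $ i)"
    by (rule det_diagonal)
  also have "\<dots> = L $ 2 $ 2"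
    unfolding UNIV_four by (simp add: e)
  finally have "L $ 2 $ 2 = 1" using L(2) by simp
  with e w show ?thesis by (simp add: vec_eq_iff forall_four mat_def col)
qed

text \<open>Peel off a boost that matches the image of the time axis, then a rotation that matches
  the third axis, then a rotation about the third axis that matches the first. What is left is the
  identity.\<close>

theorem spinor_map_surj:
  assumes "proper_orthochronous L"
  obtains A where "det A = 1" "spinor_map A = L"
proof -
  have L: "L ** minkowski ** transpose L = minkowski" "det L = 1" "L $ 0 $ 0 > 0"
    using assms by (simp_all add: proper_orthochronous_def)
  have "(L *v axis 0 1) \<bullet> (minkowski *v (L *v axis 0 1)) = 1"
    by (simp add: lorentz_columns[OF L(1)]) (simp add: minkowski_def)
  moreover have "(L *v axis 0 1) $ 0 > 0" using L(3) by (simp add: matrix_vector_mult_basis column_def)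
  ultimately obtain A where A: "det A = 1" "spinor_map A *v axis 0 1 = L *v axis 0 1"
    using boost_exists by blast
  obtain L1 where L1: "L1 ** minkowski ** transpose L1 = minkowski" "det L1 = 1" "L = spinor_map A ** L1"
    and peel_L1: "\<And>x y. spinor_map A *v x = L *v y \<Longrightarrow> L1 *v y = x"
    by (rule lorentz_peel[OF L(1,2) A(1)]) blast
  have L1_fix: "L1 *v axis 0 1 = axis 0 1"
    using A(2) by (simp_all add: peel_L1)
  have "(L1 *v axis 3 1) $ 0 = 0" "(L1 *v axis 3 1) \<bullet> (minkowski *v (L1 *v axis 3 1)) = - 1"
    using lorentz_columns[OF L1(1), of 0 3] lorentz_columns[OF L1(1), of 3 3]
    by (simp_all add: L1_fix minkowski_inner) (simp_all add: axis_def minkowski_def)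
  then obtain U where U: "det U = 1" "spinor_map U *v axis 0 1 = axis 0 1" "spinor_map U *v axis 3 1 = L1 *v axis 3 1"
    using rotation_exists by blast
  obtain L2 where L2: "L2 ** minkowski ** transpose L2 = minkowski" "det L2 = 1" "L1 = spinor_map U ** L2"
    and peel_L2: "\<And>x y. spinor_map U *v x = L1 *v y \<Longrightarrow> L2 *v y = x"
    by (rule lorentz_peel[OF L1(1,2) U(1)]) blast
  have L2_fix: "L2 *v axis 0 1 = axis 0 1" "L2 *v axis 3 1 = axis 3 1"
    using U(2,3) L1_fix by (simp_all add: peel_L2)
  have "(L2 *v axis 1 1) $ 0 = 0" "(L2 *v axis 1 1) $ 3 = 0"
    "(L2 *v axis 1 1) \<bullet> (minkowski *v (L2 *v axis 1 1)) = - 1"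
    using lorentz_columns[OF L2(1), of 0 1] lorentz_columns[OF L2(1), of 3 1] lorentz_columns[OF L2(1), of 1 1]
    by (simp_all add: L2_fix minkowski_inner) (simp_all add: axis_def minkowski_def)
  then obtain V where V: "det V = 1" "spinor_map V *v axis 0 1 = axis 0 1"
    "spinor_map V *v axis 3 1 = axis 3 1" "spinor_map V *v axis 1 1 = L2 *v axis 1 1"
    using axial_rotation_exists by blast
  obtain L3 where L3: "L3 ** minkowski ** transpose L3 = minkowski" "det L3 = 1" "L2 = spinor_map V ** L3"
    and peel_L3: "\<And>x y. spinor_map V *v x = L2 *v y \<Longrightarrow> L3 *v y = x"
    by (rule lorentz_peel[OF L2(1,2) V(1)]) blast
  have L3_fix: "L3 *v axis 0 1 = axis 0 1" "L3 *v axis 3 1 = axis 3 1" "L3 *v axis 1 1 = axis 1 1"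
    using V(2-) L2_fix by (simp_all add: peel_L3)
  have "L3 = mat 1" using lorentz_fixing_three_axes L3 L3_fix by blast
  then have "spinor_map (A ** U ** V) = L"
    by (simp add: spinor_map_mult L1(3) L2(3) L3(3) matrix_mul_assoc)
  then show thesis using that[of "A ** U ** V"] A U V by (simp add: det_mul)
qed

section \<open>Correlation matrices\<close>

lemma tensor_sum:
  "tensor_mat (\<Sum>k\<in>K. P k) (\<Sum>l\<in>L. Q l) = (\<Sum>k\<in>K. \<Sum>l\<in>L. tensor_mat (P k) (Q l))"
  by (simp add: vec_eq_iff tensor_mat_def sum_product)

lemma trace_mult_sum: "trace (X ** (\<Sum>k\<in>K. P k)) = (\<Sum>k\<in>K. trace (X ** P k))"
  for X :: "complex ^ 'n ^ 'm"
proof -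
  have "trace (X ** (\<Sum>k\<in>K. P k)) = (\<Sum>i\<in>UNIV. \<Sum>j\<in>UNIV. \<Sum>k\<in>K. X $ i $ j * P k $ j $ i)"
    by (simp add: trace_def matrix_matrix_mult_def sum_distrib_left)
  also have "\<dots> = (\<Sum>i\<in>UNIV. \<Sum>k\<in>K. \<Sum>j\<in>UNIV. X $ i $ j * P k $ j $ i)"
    by (intro sum.cong refl sum.swap)
  also have "\<dots> = (\<Sum>k\<in>K. \<Sum>i\<in>UNIV. \<Sum>j\<in>UNIV. X $ i $ j * P k $ j $ i)"
    by (rule sum.swap)
  finally show ?thesis by (simp add: trace_def matrix_matrix_mult_def)
qed

lemma trace_tensor_sum:
  "trace (X ** tensor_mat (\<Sum>k\<in>K. mscale (c k) (P k)) (\<Sum>l\<in>L. mscale (d l) (Q l))) =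
     (\<Sum>k\<in>K. \<Sum>l\<in>L. c k * d l * trace (X ** tensor_mat (P k) (Q l)))"
  by (simp add: tensor_sum trace_mult_sum tensor_mscale mscale_mult_right trace_mscale)

text \<open>A relation instead of a function: it also records that the traces are real.\<close>

definition correlation_matrix ::
  "complex ^ (2 \<times> 2) ^ (2 \<times> 2) \<Rightarrow> real ^ 4 ^ 4 \<Rightarrow> bool" where
  "correlation_matrix \<rho> R \<longleftrightarrow>
     (\<forall>i j. complex_of_real (R $ i $ j) = trace (\<rho> ** tensor_mat (pauli i) (pauli j)))"

text \<open>Cyclicity of the trace moves the local maps onto the Pauli matrices, where
  \<open>adjoint_pauli_conj\<close> expands each tensor factor separately.\<close>

lemma correlation_matrix_congruence:
  assumes "correlation_matrix \<rho> R"
  shows "correlation_matrix (tensor_mat A B ** \<rho> ** adjoint_mat (tensor_mat A B))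
           (spinor_map A ** R ** transpose (spinor_map B))"
  unfolding correlation_matrix_def
proof (intro allI)
  fix i j
  let ?T = "tensor_mat A B"
  have "trace (?T ** \<rho> ** adjoint_mat ?T ** tensor_mat (pauli i) (pauli j))
      = trace (\<rho> ** (adjoint_mat ?T ** tensor_mat (pauli i) (pauli j) ** ?T))"
    using trace_mul_sym[of ?T "\<rho> ** adjoint_mat ?T ** tensor_mat (pauli i) (pauli j)"]
    by (simp add: matrix_mul_assoc)
  also have "adjoint_mat ?T ** tensor_mat (pauli i) (pauli j) ** ?T =
      tensor_mat (adjoint_mat A ** pauli i ** A) (adjoint_mat B ** pauli j ** B)"
    by (simp add: adjoint_tensor tensor_mult)
  also have "trace (\<rho> ** \<dots>) = (\<Sum>k\<in>UNIV. \<Sum>l\<in>UNIV.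
      of_real (spinor_map A $ i $ k) * of_real (spinor_map B $ j $ l) * of_real (R $ k $ l))"
    using assms by (simp add: adjoint_pauli_conj trace_tensor_sum correlation_matrix_def)
  also have "\<dots> = of_real ((spinor_map A ** R ** transpose (spinor_map B)) $ i $ j)"
    by (subst sum.swap) (simp add: matrix_matrix_mult_def transpose_def sum_distrib_left mult_ac)
  finally show "of_real ((spinor_map A ** R ** transpose (spinor_map B)) $ i $ j) =
      trace (?T ** \<rho> ** adjoint_mat ?T ** tensor_mat (pauli i) (pauli j))" ..
qed

lemma pauli_expansion: "A = (\<Sum>k\<in>UNIV. mscale (trace (pauli k ** A) / 2) (pauli k))"
  by (rule mat22_cases[of A]) (simp add: sum_four field_simps)

text \<open>The Pauli matrices span all 2 x 2 matrices, so \<open>R\<close> determines the trace of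
  the state against every product operator. Products of matrix units \<open>E\<close> read off the
  single entries.\<close>

lemma correlation_matrix_inject:
  assumes "correlation_matrix \<rho> R" "correlation_matrix \<rho>' R"
  shows "\<rho> = \<rho>'"
proof -
  have tr: "trace (\<rho> ** tensor_mat A B) = trace (\<rho>' ** tensor_mat A B)" for A B
    using assms by (subst (1 2) pauli_expansion[of A], subst (1 2) pauli_expansion[of B])
      (simp add: trace_tensor_sum correlation_matrix_def)
  define E :: "2 \<Rightarrow> 2 \<Rightarrow> complex ^ 2 ^ 2" where "E a b = (\<chi> i j. if i = a \<and> j = b then 1 else 0)" for a b
  have entry: "trace (X ** tensor_mat (E (fst j) (fst i)) (E (snd j) (snd i))) = X $ i $ j" for X i j
  proof -
    have "tensor_mat (E (fst j) (fst i)) (E (snd j) (snd i)) $ b $ a = (if a = i then if b = j then 1 else 0 else 0)" for a b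
      by (auto simp: tensor_mat_def E_def prod_eq_iff)
    then show ?thesis
      by (simp add: trace_def matrix_matrix_mult_def if_distrib[of "(*) _"] cong: if_cong)
        (simp add: if_distrib[of "sum _"] sum.If_cases)
  qed
  show ?thesis by (simp add: vec_eq_iff flip: entry) (simp add: tr)
qed

text \<open>The operator \<open>p/2 (|00><00| + |11><11|) + d/2 (|00><11| + |11><00|) + q |10><10|\<close>.\<close>

definition canonical_state :: "real \<Rightarrow> real \<Rightarrow> real \<Rightarrow> complex ^ (2 \<times> 2) ^ (2 \<times> 2)" where
  "canonical_state p q d =
     (\<chi> i j. if i = (1, 0) \<and> j = (1, 0) then of_real q
        else if i = j \<and> fst i = snd i then of_real p / 2
        else if fst i = snd i \<and> fst j = snd j then of_real d / 2 else 0)"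

text \<open>The source of the constraints on \<open>\<Sigma>\<close>: the equations
  \<open>a - b = a + c = p\<close> say exactly that a = p + q, b = q and c = - q.\<close>

lemma correlation_matrix_canonical:
  "correlation_matrix (canonical_state p q d) (Sigma_form (p + q) q (- q) d)"
  unfolding correlation_matrix_def forall_four
  by (simp add: Sigma_form_def canonical_state_def trace_def matrix_matrix_mult_def sum_bits sum_bit
      tensor_mat_def)

section \<open>Rank bounds for congruences of the normal form\<close>

lemma rank_mult_le:
  fixes X :: "'a::field ^ 'n ^ 'm" and M :: "'a ^ 'k ^ 'n"
  assumes "finite S" "\<And>i. row i M \<in> vec.span S"
  shows "rank (X ** M) \<le> card S"
proof -
  have "row i (X ** M) \<in> vec.span S" for i
  proof -
    have "row i (X ** M) = (\<Sum>j\<in>UNIV. X $ i $ j *s row j M)"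
      by (simp add: vec_eq_iff row_def matrix_matrix_mult_def)
    then show ?thesis
      using assms by (simp add: vec.span_sum vec.span_scale)
  qed
  then have "rows (X ** M) \<subseteq> vec.span S" by (auto simp: rows_def)
  then show ?thesis unfolding row_rank_def_gen by (rule vec.dim_le_card) (rule assms)
qed

text \<open>With \<open>\<bar>d\<bar> = p\<close> the row of |11> is \<open>sgn d\<close> times the
  row of |00>, and the row of |01> is zero. So two rows span the others, and only the row of |10>
  survives when p = 0.\<close>

lemma rank_canonical_congruence:
  assumes "\<bar>d\<bar> = p"
  shows "rank (Y ** canonical_state p q d ** Z) \<le> 2"
    and "p = 0 \<Longrightarrow> rank (Y ** canonical_state p q d ** Z) \<le> 1"
proof -
  let ?C = "canonical_state p q d"
  let ?r = "\<lambda>i. row i (?C ** Z)"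
  have row: "?r i $ j = (\<Sum>k\<in>UNIV. ?C $ i $ k * Z $ k $ j)" for i j
    by (simp add: row_def matrix_matrix_mult_def)
  have rows: "?r (0, 1) = 0" "?r (1, 1) = of_real (sgn d) *s ?r (0, 0)" "p = 0 \<Longrightarrow> ?r (0, 0) = 0"
    using assms unfolding vec_eq_iff vector_smult_component row
    by (auto simp: canonical_state_def sum_bits sum_bit sgn_if algebra_simps split: if_splits)
  have "\<forall>i. ?r i \<in> vec.span {?r (0, 0), ?r (1, 0)}"
    unfolding forall_bits by (simp add: rows vec.span_base vec.span_scale vec.span_zero)
  then have "rank (Y ** (?C ** Z)) \<le> card {?r (0, 0), ?r (1, 0)}"
    by (intro rank_mult_le) auto
  also have "\<dots> \<le> 2" by (simp add: card_insert_if)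
  finally show "rank (Y ** ?C ** Z) \<le> 2" by (simp add: matrix_mul_assoc)
  assume "p = 0"
  then have "\<forall>i. ?r i \<in> vec.span {?r (1, 0)}"
    unfolding forall_bits rows(1,2) rows(3)[OF \<open>p = 0\<close>]
    by (simp add: vec.span_base vec.span_zero)
  then have "rank (Y ** (?C ** Z)) \<le> card {?r (1, 0)}"
    by (intro rank_mult_le) auto
  then show "rank (Y ** ?C ** Z) \<le> 1" by (simp add: matrix_mul_assoc)
qed

section \<open>Filtering the normal form\<close>

text \<open>The quadratic form of \<open>H\<close> at \<open>v\<close> is at most \<open>K\<close>
  times the squared length of \<open>v\<close>, with \<open>K\<close> the sum of the moduli of the
  entries; scaling by a small enough \<open>s\<close> brings it below 1.\<close>

lemma contraction_exists:
  fixes A :: "complex ^ 'n ^ 'n"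
  obtains s where "s > 0" "loewner_le (adjoint_mat (mscale (of_real s) A) ** mscale (of_real s) A) (mat 1)"
proof -
  define H where "H = adjoint_mat A ** A"
  define K where "K = (\<Sum>i\<in>UNIV. \<Sum>j\<in>UNIV. cmod (H $ i $ j))"
  have "K \<ge> 0" by (auto simp: K_def intro!: sum_nonneg)
  \<comment> \<open>The summand 1 keeps the denominator positive even for the zero matrix.\<close>
  define s where "s = 1 / sqrt (1 + K)"
  have s: "s > 0" "s * s = 1 / (1 + K)" using \<open>K \<ge> 0\<close> by (simp_all add: s_def)
  have sH: "adjoint_mat (mscale (of_real s) A) ** mscale (of_real s) A = mscale (of_real (s * s)) H"
    by (simp add: H_def adjoint_mscale mscale_mult_left mscale_mult_right)
  let ?D = "mat 1 - mscale (of_real (s * s)) H"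
  have "adjoint_mat H = H" by (simp add: H_def adjoint_mult)
  then have H: "cnj (H $ j $ i) = H $ i $ j" for i j
    by (metis (no_types, lifting) adjoint_mat_def vec_lambda_beta)
  have "adjoint_mat ?D = ?D"
    by (simp add: vec_eq_iff adjoint_mat_def mat_def mscale_def H)
  moreover have "0 \<le> Re (\<Sum>i\<in>UNIV. \<Sum>j\<in>UNIV. cnj (v $ i) * ?D $ i $ j * v $ j)" for v
  proof -
    define q where "q = (\<Sum>i\<in>UNIV. \<Sum>j\<in>UNIV. cnj (v $ i) * H $ i $ j * v $ j)"
    have "(\<Sum>j\<in>UNIV. cnj (v $ i) * mat 1 $ i $ j * v $ j) = of_real ((cmod (v $ i))\<^sup>2)" for i
    proof -
      have "(\<Sum>j\<in>UNIV. cnj (v $ i) * mat 1 $ i $ j * v $ j) = (\<Sum>j\<in>UNIV. if i = j then cnj (v $ i) * v $ j else 0)"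
        by (intro sum.cong) (auto simp: mat_def)
      also have "\<dots> = cnj (v $ i) * v $ i" by simp
      finally show ?thesis by (metis complex_norm_square mult.commute)
    qed
    then have "(\<Sum>i\<in>UNIV. \<Sum>j\<in>UNIV. cnj (v $ i) * ?D $ i $ j * v $ j) =
        of_real (\<Sum>i\<in>UNIV. (cmod (v $ i))\<^sup>2) - of_real (s * s) * q"
      by (simp add: q_def mscale_def ring_distribs sum_subtractf sum_distrib_left mult_ac)
    also have "(\<Sum>i\<in>UNIV. (cmod (v $ i))\<^sup>2) = (norm v)\<^sup>2"
      by (simp add: norm_vec_def L2_set_def sum_nonneg)
    finally have eq: "Re (\<Sum>i\<in>UNIV. \<Sum>j\<in>UNIV. cnj (v $ i) * ?D $ i $ j * v $ j) =
        (norm v)\<^sup>2 - s * s * Re q" by simp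
    have "cmod q \<le> (\<Sum>i\<in>UNIV. \<Sum>j\<in>UNIV. cmod (cnj (v $ i) * H $ i $ j * v $ j))"
      unfolding q_def by (intro order_trans[OF norm_sum] sum_mono norm_sum)
    also have "\<dots> \<le> (\<Sum>i\<in>UNIV. \<Sum>j\<in>UNIV. cmod (H $ i $ j) * (norm v)\<^sup>2)"
    proof (intro sum_mono)
      fix i j
      have "cmod (v $ i) * cmod (v $ j) \<le> norm v * norm v"
        by (intro mult_mono) (simp_all add: Finite_Cartesian_Product.norm_nth_le)
      then have "cmod (H $ i $ j) * (cmod (v $ i) * cmod (v $ j)) \<le> cmod (H $ i $ j) * (norm v * norm v)"
        by (intro mult_left_mono) auto
      then show "cmod (cnj (v $ i) * H $ i $ j * v $ j) \<le> cmod (H $ i $ j) * (norm v)\<^sup>2"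
        by (simp add: norm_mult power2_eq_square mult_ac)
    qed
    also have "\<dots> = K * (norm v)\<^sup>2" by (simp add: K_def sum_distrib_right)
    finally have "Re q \<le> K * (norm v)\<^sup>2" using complex_Re_le_cmod order_trans by blast
    then have "s * s * Re q \<le> s * s * (K * (norm v)\<^sup>2)"
      by (intro mult_left_mono) auto
    also have "\<dots> \<le> (norm v)\<^sup>2"
    proof -
      have "s * s * K \<le> 1" using \<open>K \<ge> 0\<close> unfolding s(2) by simp
      then show ?thesis using mult_right_mono[of "s * s * K" 1 "(norm v)\<^sup>2"] by simp
    qed
    finally show ?thesis unfolding eq by simp
  qed
  ultimately have "psd ?D" unfolding psd_def by blast
  then show thesis using that[OF s(1)] by (simp add: loewner_le_def sH)
qed

lemma filtered_mscale:
  assumes "s \<noteq> 0" "t \<noteq> 0"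
  shows "filtered (mscale s A) (mscale t B) \<rho> = filtered A B \<rho>"
  using assms
  by (simp add: filtered_def Let_def tensor_mscale adjoint_mscale mscale_mult_left mscale_mult_right
      trace_mscale)

text \<open>Normalization of the output cancels scalar factors, so the contraction condition can be
  met for any invertible pair without changing the filtered state.\<close>

lemma filter_pair_exists:
  assumes "det A \<noteq> 0" "det B \<noteq> 0"
  obtains A' B' where "filter_pair A' B'" "filtered A' B' = filtered A B"
proof -
  obtain s where s: "s > 0" "loewner_le (adjoint_mat (mscale (of_real s) A) ** mscale (of_real s) A) (mat 1)"
    using contraction_exists .
  obtain t where t: "t > 0" "loewner_le (adjoint_mat (mscale (of_real t) B) ** mscale (of_real t) B) (mat 1)"
    using contraction_exists .
  show thesis
    by (rule that[of "mscale (of_real s) A" "mscale (of_real t) B"])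
      (use s t assms in \<open>auto simp: filter_pair_def invertible_det_nz det_mscale_22 filtered_mscale fun_eq_iff\<close>)
qed

lemma tensor_congruence:
  "tensor_mat A B ** (tensor_mat C D ** \<rho> ** adjoint_mat (tensor_mat C D)) ** adjoint_mat (tensor_mat A B) =
   tensor_mat (A ** C) (B ** D) ** \<rho> ** adjoint_mat (tensor_mat (A ** C) (B ** D))"
  by (simp add: adjoint_mult matrix_mul_assoc flip: tensor_mult)

definition ket11 :: "complex ^ (2 \<times> 2) ^ (2 \<times> 2)" where
  "ket11 = (\<chi> i j. if i = (1, 1) \<and> j = (1, 1) then 1 else 0)"

lemma singlet_nth: "singlet $ i $ j = 
   (if fst i = snd i \<or> fst j = snd j then 0 else if i = j then 1 / 2 else - 1 / 2)"
proof -
  have "complex_of_real (sqrt 2) * complex_of_real (sqrt 2) = 2"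
    by (simp flip: of_real_mult)
  then have "\<forall>i j. singlet $ i $ j = (if fst i = snd i \<or> fst j = snd j then 0 else if i = j then 1 / 2 else - 1 / 2)"
    unfolding forall_bits by (simp add: singlet_def singlet_vec_def divide_simps)
  then show ?thesis by blast
qed

text \<open>The second filter is diag(t,1) followed by a local map that carries |00> + sgn(d) |11>
  to the singlet direction. The entangled vector loses a factor t in amplitude and |10> a factor of
  t squared, whence the weights.\<close>

lemma filtered_canonical:
  assumes "p = \<bar>d\<bar>" "d \<noteq> 0" "t \<noteq> 0"
  shows "tensor_mat (mat22 1 0 0 (of_real t)) (mat22 0 (- of_real (sgn d)) (of_real t) 0) ** canonical_state p q d **
      adjoint_mat (tensor_mat (mat22 1 0 0 (of_real t)) (mat22 0 (- of_real (sgn d)) (of_real t) 0)) =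
    mscale (of_real (p * t\<^sup>2)) singlet + mscale (of_real (q * t ^ 4)) ket11"
proof -
  have sg: "sgn d = 1 \<and> d = p \<or> sgn d = - 1 \<and> d = - p" using assms by (auto simp: sgn_if)
  show ?thesis
    unfolding vec_eq_iff forall_bits using sg
    by (auto simp: matrix_matrix_mult_def sum_bits sum_bit tensor_mat_def adjoint_mat_def canonical_state_def
        mscale_def ket11_def singlet_nth power2_eq_square power4_eq_xxxx)
qed

text \<open>Undo \<open>A\<close> and \<open>B\<close> by their inverses, then apply the damping
  filter. After normalization the state is a combination of \<open>singlet\<close> and
  \<open>ket11\<close> in which \<open>ket11\<close> has weight \<open>?w t\<close>, and this weight
  tends to 0 with t.\<close>

lemma quasi_purifiable_canonical:
  assumes N: "matrix_norm N" and det: "det A = 1" "det B = 1" and d: "p = \<bar>d\<bar>" "d \<noteq> 0"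
  shows "quasi_purifiable N (tensor_mat A B ** canonical_state p q d ** adjoint_mat (tensor_mat A B))"
    (is "quasi_purifiable N ?\<rho>")
  unfolding quasi_purifiable_def
proof (intro allI impI)
  fix \<epsilon> :: real
  assume "\<epsilon> > 0"
  obtain A' where A': "det A' = 1" "A' ** A = mat 1" using unimodular_inverse[OF det(1)] .
  obtain B' where B': "det B' = 1" "B' ** B = mat 1" using unimodular_inverse[OF det(2)] .
  have "p > 0" using d by simp
  let ?w = "\<lambda>t. q * t\<^sup>2 / (p + q * t\<^sup>2)"
  have "((\<lambda>t. \<bar>?w t\<bar> * N (ket11 - singlet)) \<longlongrightarrow> \<bar>q * 0\<^sup>2 / (p + q * 0\<^sup>2)\<bar> * N (ket11 - singlet)) (at_right 0)"
    using \<open>p > 0\<close> by (intro tendsto_intros) auto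
  then have "\<forall>\<^sub>F t in at_right 0. \<bar>?w t\<bar> * N (ket11 - singlet) < \<epsilon>"
    using \<open>\<epsilon> > 0\<close> by (intro order_tendstoD(2)) auto
  \<comment> \<open>The sign of \<open>q\<close> is left open here, so positivity of this factor of
    the trace is obtained for small t only.\<close>
  moreover have "((\<lambda>t. p + q * t\<^sup>2) \<longlongrightarrow> p + q * 0\<^sup>2) (at_right (0 :: real))"
    by (intro tendsto_intros)
  then have "\<forall>\<^sub>F t in at_right 0. p + q * t\<^sup>2 > 0"
    using \<open>p > 0\<close> by (intro order_tendstoD(1)) auto
  moreover have "\<forall>\<^sub>F t in at_right (0 :: real). t > 0" by (rule eventually_at_right_less)
  ultimately have "\<forall>\<^sub>F t in at_right 0. \<bar>?w t\<bar> * N (ket11 - singlet) < \<epsilon> \<and> p + q * t\<^sup>2 > 0 \<and> t > 0"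
    by eventually_elim simp
  then obtain t where t: "\<bar>?w t\<bar> * N (ket11 - singlet) < \<epsilon>" "p + q * t\<^sup>2 > 0" "t > 0"
    using eventually_happens by (metis (lifting) trivial_limit_at_right_real)
  let ?C = "mat22 1 0 0 (of_real t)" and ?D = "mat22 0 (- of_real (sgn d)) (of_real t) 0"
  obtain F G where FG: "filter_pair F G" "filtered F G = filtered (?C ** A') (?D ** B')"
  proof (rule filter_pair_exists)
    show "det (?C ** A') \<noteq> 0" "det (?D ** B') \<noteq> 0"
      using A' B' t d by (simp_all add: det_mul sgn_if)
  qed
  have CA: "?C ** A' ** A = ?C" and DB: "?D ** B' ** B = ?D"
    by (simp_all only: A' B' matrix_mul_rid flip: matrix_mul_assoc)
  let ?X = "mscale (of_real (p * t\<^sup>2)) singlet + mscale (of_real (q * t ^ 4)) ket11"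
  have "tensor_mat (?C ** A') (?D ** B') ** ?\<rho> ** adjoint_mat (tensor_mat (?C ** A') (?D ** B')) = ?X"
    using d t by (simp only: tensor_congruence CA DB) (intro filtered_canonical, auto)
  moreover have "trace ?X = of_real (t\<^sup>2 * (p + q * t\<^sup>2))"
    by (simp add: trace_def sum_bits sum_bit mscale_def singlet_nth ket11_def algebra_simps
        power2_eq_square power4_eq_xxxx)
  ultimately have "filtered F G ?\<rho> = mscale (1 / of_real (t\<^sup>2 * (p + q * t\<^sup>2))) ?X"
    unfolding FG(2) filtered_def Let_def by (simp only:)
  also have "\<dots> - singlet = mscale (of_real (?w t)) (ket11 - singlet)"
  proof -
    have mix: "1 / (T * (P + Q * T)) * (P * T * x + Q * (T * T) * y) - x = Q * T / (P + Q * T) * (y - x)"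
      if "T \<noteq> 0" "P + Q * T \<noteq> 0" for P Q T x y :: complex
      using that by (simp add: divide_simps) (simp add: algebra_simps)
    have "complex_of_real (t\<^sup>2) \<noteq> 0" "complex_of_real p + of_real q * of_real (t\<^sup>2) \<noteq> 0"
      using t(2,3) by (simp_all only: of_real_eq_0_iff flip: of_real_mult of_real_add) simp_all
    from mix[OF this] show ?thesis
      by (simp add: vec_eq_iff mscale_def power2_eq_square power4_eq_xxxx mult.assoc)
  qed
  finally have "N (filtered F G ?\<rho> - singlet) = \<bar>?w t\<bar> * N (ket11 - singlet)"
    using N unfolding matrix_norm_def by (metis norm_of_real)
  with t(1) have "N (filtered F G ?\<rho> - singlet) < \<epsilon>" by (simp only:)
  with FG(1) show "\<exists>A B. filter_pair A B \<and> N (filtered A B ?\<rho> - singlet) < \<epsilon>" by blast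
qed

text \<open>Lift both Lorentz transformations to unimodular matrices. The congruence of the normal
  form by the lifts has correlation matrix \<open>R\<close>, hence it is \<rho>.\<close>

lemma quasi_purifiable_if_Sigma_form:
  assumes N: "matrix_norm N" and \<rho>: "rank \<rho> \<ge> 2" "correlation_matrix \<rho> R"
    and L: "proper_orthochronous L1" "proper_orthochronous L2"
    and R: "R = L1 ** Sigma_form a b c d ** transpose L2" "a - b = a + c" "a + c = \<bar>d\<bar>"
  shows "quasi_purifiable N \<rho>"
proof -
  obtain A where A: "det A = 1" "spinor_map A = L1" using spinor_map_surj[OF L(1)] .
  obtain B where B: "det B = 1" "spinor_map B = L2" using spinor_map_surj[OF L(2)] .
  have "a = \<bar>d\<bar> + b" "c = - b" using R(2,3) by auto
  then have "R = spinor_map A ** Sigma_form (\<bar>d\<bar> + b) b (- b) d ** transpose (spinor_map B)"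
    using R(1) A B by simp
  then have "correlation_matrix (tensor_mat A B ** canonical_state \<bar>d\<bar> b d ** adjoint_mat (tensor_mat A B)) R"
    using correlation_matrix_congruence[OF correlation_matrix_canonical] by simp
  then have eq: "\<rho> = tensor_mat A B ** canonical_state \<bar>d\<bar> b d ** adjoint_mat (tensor_mat A B)"
    by (rule correlation_matrix_inject[OF \<rho>(2)])
  \<comment> \<open>For d = 0 the entangled part disappears and the rank drops to at most
    one.\<close>
  have "d \<noteq> 0"
  proof
    assume "d = 0"
    then have "rank \<rho> \<le> 1" unfolding eq by (intro rank_canonical_congruence(2)) auto
    then show False using \<rho>(1) by simp
  qed
  then show ?thesis unfolding eq by (intro quasi_purifiable_canonical N A B) auto
qed

section \<open>Cholesky factorization and matrices of rank one\<close>

text \<open>With a zero diagonal entry at k, the form at \<open>x\<close> times the k-th axis plus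
  the j-th axis is affine in \<open>x\<close>, so a nonzero \<open>M $ k $ j\<close> would make it
  negative somewhere.\<close>

lemma psd_row_eq_0:
  assumes M: "psd M" and k: "M $ k $ k = 0"
  shows "M $ k $ j = 0"
proof (rule ccontr)
  assume nz: "M $ k $ j \<noteq> 0"
  then have "j \<noteq> k" using k by auto
  have "adjoint_mat M = M" using M by (simp add: psd_def)
  then have herm: "M $ j $ k = cnj (M $ k $ j)"
    by (metis (no_types, lifting) adjoint_mat_def vec_lambda_beta)
  define m where "m = (cmod (M $ k $ j))\<^sup>2"
  have "m > 0" using nz by (simp add: m_def)
  \<comment> \<open>Chosen so that the quadratic form at \<open>v\<close> has value -1.\<close>
  define y where "y = (Re (M $ j $ j) + 1) / (2 * m)"
  define x where "x = - of_real y * M $ k $ j"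
  define v :: "complex ^ 'a" where "v = (\<chi> i. if i = k then x else if i = j then 1 else 0)"
  have v: "(\<Sum>i\<in>UNIV. g i * v $ i) = g k * x + g j" for g
  proof -
    have "(\<Sum>i\<in>UNIV. g i * v $ i) = (\<Sum>i\<in>{k, j}. g i * v $ i)"
      by (rule sum.mono_neutral_right) (auto simp: v_def)
    then show ?thesis using \<open>j \<noteq> k\<close> by (simp add: v_def)
  qed
  have v': "(\<Sum>i\<in>UNIV. cnj (v $ i) * g i) = cnj x * g k + g j" for g
    using arg_cong[OF v[of "\<lambda>i. cnj (g i)"], of cnj] by (simp add: mult.commute)
  have "(\<Sum>i\<in>UNIV. \<Sum>l\<in>UNIV. cnj (v $ i) * M $ i $ l * v $ l)
      = (\<Sum>i\<in>UNIV. cnj (v $ i) * (\<Sum>l\<in>UNIV. M $ i $ l * v $ l))"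
    by (simp add: sum_distrib_left mult.assoc)
  also have "\<dots> = cnj x * M $ k $ j + x * M $ j $ k + M $ j $ j"
    by (simp add: v v' k)
  also have "\<dots> = - 2 * of_real (y * m) + M $ j $ j"
    by (simp add: x_def herm m_def complex_norm_square algebra_simps del: of_real_power)
  finally have "0 \<le> - 2 * (y * m) + Re (M $ j $ j)"
    using M unfolding psd_def by (metis (no_types, lifting) Re_complex_of_real of_real_minus of_real_mult of_real_numeral plus_complex.sel(1))
  moreover have "y * m = (Re (M $ j $ j) + 1) / 2" using \<open>m > 0\<close> by (simp add: y_def)
  ultimately show False by argo
qed

lemma psd_diag:
  assumes "psd M"
  obtains m where "m \<ge> 0" "M $ k $ k = of_real m"
proof -
  have "adjoint_mat M = M" using assms by (simp add: psd_def)
  then have "cnj (M $ k $ k) = M $ k $ k"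
    by (metis (no_types, lifting) adjoint_mat_def vec_lambda_beta)
  then have "M $ k $ k = of_real (Re (M $ k $ k))" by (simp add: complex_eq_iff)
  moreover have "0 \<le> Re (\<Sum>i\<in>UNIV. \<Sum>j\<in>UNIV. cnj (axis k 1 $ i) * M $ i $ j * axis k 1 $ j)"
    using assms by (simp add: psd_def)
  then have "0 \<le> Re (M $ k $ k)"
    by (simp add: axis_def if_distrib[of cnj] if_distrib[of "(*) _"] if_distrib[of "\<lambda>x. x * _"] cong: if_cong)
  ultimately show thesis using that by blast
qed

text \<open>Completing the square: the form of the complement at \<open>v\<close> is the form of
  \<open>M\<close> at \<open>w\<close>, the shift of \<open>v\<close> along the k-th axis for which
  the k-th entry of \<open>M *v w\<close> vanishes.\<close>

lemma psd_schur_complement: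
  assumes M: "psd M" and m: "M $ k $ k = of_real m" "m > 0"
  shows "psd (\<chi> i j. M $ i $ j - M $ i $ k * M $ k $ j / of_real m)"
proof -
  have "adjoint_mat M = M" using M by (simp add: psd_def)
  then have herm: "cnj (M $ j $ i) = M $ i $ j" for i j
    by (metis (no_types, lifting) adjoint_mat_def vec_lambda_beta)
  have "0 \<le> Re (\<Sum>i\<in>UNIV. \<Sum>j\<in>UNIV. cnj (v $ i) * (M $ i $ j - M $ i $ k * M $ k $ j / of_real m) * v $ j)" for v
  proof -
    define s where "s = (\<Sum>j\<in>UNIV. M $ k $ j * v $ j)"
    define Q where "Q = (\<Sum>i\<in>UNIV. \<Sum>j\<in>UNIV. cnj (v $ i) * M $ i $ j * v $ j)"
    define w where "w = v - (s / of_real m) *s axis k 1"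
    have s': "cnj s = (\<Sum>i\<in>UNIV. cnj (v $ i) * M $ i $ k)"
      by (simp add: s_def herm mult.commute)
    have w: "w $ i = v $ i - (if i = k then s / of_real m else 0)" for i
      by (simp add: w_def axis_def)
    have cw: "(\<Sum>i\<in>UNIV. cnj (w $ i) * g i) = (\<Sum>i\<in>UNIV. cnj (v $ i) * g i) - cnj (s / of_real m) * g k" for g
      by (simp add: w left_diff_distrib sum_subtractf if_distrib[of cnj] if_distrib[of "\<lambda>x. x * _"] cong: if_cong)
    have Mw: "(\<Sum>j\<in>UNIV. M $ i $ j * w $ j) = (\<Sum>j\<in>UNIV. M $ i $ j * v $ j) - M $ i $ k * s / of_real m" for i
      by (simp add: w ring_distribs sum_subtractf if_distrib[of "(*) _"] cong: if_cong)
    have "(\<Sum>i\<in>UNIV. \<Sum>j\<in>UNIV. cnj (w $ i) * M $ i $ j * w $ j)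
        = (\<Sum>i\<in>UNIV. cnj (w $ i) * ((\<Sum>j\<in>UNIV. M $ i $ j * v $ j) - M $ i $ k * s / of_real m))"
      by (simp add: sum_distrib_left mult.assoc flip: Mw)
    also have "\<dots> = (\<Sum>i\<in>UNIV. cnj (v $ i) * ((\<Sum>j\<in>UNIV. M $ i $ j * v $ j) - M $ i $ k * s / of_real m))
        - cnj (s / of_real m) * (s - M $ k $ k * s / of_real m)"
      by (simp only: cw s_def[symmetric])
    also have "s - M $ k $ k * s / of_real m = 0" using m by simp
    also have "(\<Sum>i\<in>UNIV. cnj (v $ i) * ((\<Sum>j\<in>UNIV. M $ i $ j * v $ j) - M $ i $ k * s / of_real m))
        = Q - cnj s * (s / of_real m)"
      unfolding s' by (simp add: Q_def right_diff_distrib sum_subtractf sum_distrib_left sum_distrib_right sum_divide_distrib mult.assoc)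
    finally have "(\<Sum>i\<in>UNIV. \<Sum>j\<in>UNIV. cnj (w $ i) * M $ i $ j * w $ j) = Q - cnj s * (s / of_real m)" by simp
    also have "\<dots> = (\<Sum>i\<in>UNIV. \<Sum>j\<in>UNIV. cnj (v $ i) * (M $ i $ j - M $ i $ k * M $ k $ j / of_real m) * v $ j)"
    proof -
      have "cnj s * (s / of_real m) = (\<Sum>i\<in>UNIV. \<Sum>j\<in>UNIV. cnj (v $ i) * (M $ i $ k * M $ k $ j / of_real m) * v $ j)"
        unfolding s' by (simp add: s_def sum_divide_distrib sum_product mult_ac)
      then show ?thesis by (simp add: Q_def ring_distribs sum_subtractf)
    qed
    finally have eq: "(\<Sum>i\<in>UNIV. \<Sum>j\<in>UNIV. cnj (w $ i) * M $ i $ j * w $ j) = \<dots>" .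
    have "0 \<le> Re (\<Sum>i\<in>UNIV. \<Sum>j\<in>UNIV. cnj (w $ i) * M $ i $ j * w $ j)"
      using M unfolding psd_def by blast
    then show ?thesis unfolding eq .
  qed
  moreover have "adjoint_mat (\<chi> i j. M $ i $ j - M $ i $ k * M $ k $ j / of_real m) =
      (\<chi> i j. M $ i $ j - M $ i $ k * M $ k $ j / of_real m)"
    by (simp add: vec_eq_iff adjoint_mat_def herm mult.commute)
  ultimately show ?thesis by (simp add: psd_def)
qed

text \<open>Induction on the number of nonzero diagonal entries, with one Schur complement per step.
  The support clause makes column k of the inductive factor zero, so the new column can be stored
  there and the factor stays square.\<close>

lemma psd_cholesky_support:
  assumes "psd M"
  shows "\<exists>Y. M = Y ** adjoint_mat Y \<and> (\<forall>i k. M $ k $ k = 0 \<longrightarrow> Y $ i $ k = 0)"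
  using assms
proof (induction "card {k. M $ k $ k \<noteq> 0}" arbitrary: M rule: less_induct)
  case less
  show ?case
  proof (cases "\<exists>k. M $ k $ k \<noteq> 0")
    case False
    then have "M = 0" using psd_row_eq_0[OF less.prems] by (simp add: vec_eq_iff)
    then show ?thesis by (intro exI[of _ 0]) (simp add: vec_eq_iff matrix_matrix_mult_def)
  next
    case True
    then obtain k where k: "M $ k $ k \<noteq> 0" by blast
    obtain m where m: "m \<ge> 0" "M $ k $ k = of_real m" using psd_diag[OF less.prems] .
    have "m > 0" using k m by (cases "m = 0") auto
    define M' where "M' = (\<chi> i j. M $ i $ j - M $ i $ k * M $ k $ j / of_real m)"
    have "psd M'" unfolding M'_def using less.prems m(2) \<open>m > 0\<close> by (rule psd_schur_complement)
    have herm: "cnj (M $ j $ i) = M $ i $ j" for i j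
      using less.prems unfolding psd_def by (metis (no_types, lifting) adjoint_mat_def vec_lambda_beta)
    have M'0: "M' $ j $ j = 0" if "M $ j $ j = 0" for j
      using psd_row_eq_0[OF less.prems that] that by (simp add: M'_def)
    have M'k: "M' $ k $ k = 0" using m \<open>m > 0\<close> by (simp add: M'_def)
    have "{j. M' $ j $ j \<noteq> 0} \<subset> {j. M $ j $ j \<noteq> 0}" using M'0 M'k k by blast
    then have "card {j. M' $ j $ j \<noteq> 0} < card {j. M $ j $ j \<noteq> 0}" by (intro psubset_card_mono) auto
    from less.hyps[OF this \<open>psd M'\<close>] obtain Y' where Y': "M' = Y' ** adjoint_mat Y'"
      "\<And>i j. M' $ j $ j = 0 \<Longrightarrow> Y' $ i $ j = 0" by blast
    define Y where "Y = (\<chi> i j. if j = k then M $ i $ k / of_real (sqrt m) else Y' $ i $ j)"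
    have sq: "complex_of_real (sqrt m) * of_real (sqrt m) = of_real m"
      using \<open>m > 0\<close> by (simp flip: of_real_mult)
    have "(\<Sum>a\<in>UNIV. Y $ i $ a * cnj (Y $ j $ a)) = M $ i $ j" for i j
    proof -
      have "(\<Sum>a\<in>UNIV. Y $ i $ a * cnj (Y $ j $ a)) =
          (\<Sum>a\<in>UNIV. Y' $ i $ a * cnj (Y' $ j $ a) + (if a = k then M $ i $ k * M $ k $ j / of_real m else 0))"
        by (intro sum.cong) (auto simp: Y_def Y'(2)[OF M'k] herm sq)
      also have "\<dots> = M' $ i $ j + M $ i $ k * M $ k $ j / of_real m"
        unfolding Y'(1) by (simp add: sum.distrib matrix_matrix_mult_def adjoint_mat_def)
      finally show ?thesis by (simp add: M'_def)
    qed
    then have "M = Y ** adjoint_mat Y"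
      by (simp add: vec_eq_iff matrix_matrix_mult_def adjoint_mat_def)
    moreover have "Y $ i $ j = 0" if "M $ j $ j = 0" for i j
      using that k Y'(2) M'0 by (auto simp: Y_def)
    ultimately show ?thesis by blast
  qed
qed

lemma psd_cholesky:
  fixes M :: "complex ^ 'n ^ 'n"
  assumes "psd M"
  obtains Y :: "complex ^ 'n ^ 'n" where "M = Y ** adjoint_mat Y"
  using psd_cholesky_support[OF assms] by blast

text \<open>For H the product of the adjoint of \<open>T\<close> with \<open>T\<close>, expanding
  the squared moduli of all 2 x 2 minors gives twice the difference of the two sides of the
  assumption. A vanishing sum of squares has vanishing terms.\<close>

lemma minors_eq_0I:
  fixes T :: "complex ^ 'n ^ 'm"
  assumes "(trace (adjoint_mat T ** T))\<^sup>2 = trace (adjoint_mat T ** T ** (adjoint_mat T ** T))"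
  shows "T $ a $ b * T $ c $ d = T $ a $ d * T $ c $ b"
proof -
  define H where "H = adjoint_mat T ** T"
  define z where "z a b c d = T $ a $ b * T $ c $ d - T $ a $ d * T $ c $ b" for a b c d
  have H: "H $ b $ d = (\<Sum>a\<in>UNIV. cnj (T $ a $ b) * T $ a $ d)" for b d
    by (simp add: H_def matrix_matrix_mult_def adjoint_mat_def)
  have "(\<Sum>a\<in>UNIV. \<Sum>c\<in>UNIV. of_real ((cmod (z a b c d))\<^sup>2)) =
      2 * (H $ b $ b * H $ d $ d) - 2 * (H $ b $ d * H $ d $ b)" for b d
  proof -
    have "(\<Sum>a\<in>UNIV. \<Sum>c\<in>UNIV. of_real ((cmod (z a b c d))\<^sup>2)) =
       H $ b $ b * H $ d $ d - H $ b $ d * H $ d $ b - (H $ d $ b * H $ b $ d - H $ d $ d * H $ b $ b)"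
      unfolding H sum_product
      by (simp add: complex_norm_square z_def sum_subtractf[symmetric] ring_distribs mult_ac del: of_real_power)
    then show ?thesis by (simp add: mult.commute)
  qed
  moreover have "(trace H)\<^sup>2 = (\<Sum>b\<in>UNIV. \<Sum>d\<in>UNIV. H $ b $ b * H $ d $ d)"
    by (simp only: trace_def power2_eq_square sum_product)
  moreover have "trace (H ** H) = (\<Sum>b\<in>UNIV. \<Sum>d\<in>UNIV. H $ b $ d * H $ d $ b)"
    by (simp add: trace_def matrix_matrix_mult_def)
  ultimately have "(\<Sum>b\<in>UNIV. \<Sum>d\<in>UNIV. \<Sum>a\<in>UNIV. \<Sum>c\<in>UNIV. of_real ((cmod (z a b c d))\<^sup>2)) =
      2 * ((trace H)\<^sup>2 - trace (H ** H))"
    by (simp only: sum_subtractf right_diff_distrib sum_distrib_left)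
  also have "\<dots> = 0" using assms by (simp add: H_def)
  finally have "(\<Sum>b\<in>UNIV. \<Sum>d\<in>UNIV. \<Sum>a\<in>UNIV. \<Sum>c\<in>UNIV. (cmod (z a b c d))\<^sup>2) = 0"
    by (simp only: of_real_sum[symmetric] of_real_eq_0_iff)
  then have "z a b c d = 0"
    by (simp add: sum_nonneg_eq_0_iff sum_nonneg)
  then show ?thesis by (simp add: z_def)
qed

text \<open>A nonzero entry at (a,b) forces a nonzero diagonal entry, since its square is the
  product of the diagonal entries at a and b. Row a divided by a square root of its diagonal entry
  is then the vector \<open>t\<close>.\<close>

lemma symmetric_rank_one:
  fixes T :: "complex ^ 'n ^ 'n"
  assumes sym: "transpose T = T" and minors: "\<And>a b c d. T $ a $ b * T $ c $ d = T $ a $ d * T $ c $ b"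
  obtains t where "\<And>a b. T $ a $ b = t a * t b"
proof (cases "T = 0")
  case True
  then show thesis using that[of "\<lambda>_. 0"] by simp
next
  case False
  then obtain a b where ab: "T $ a $ b \<noteq> 0" by (auto simp: vec_eq_iff)
  have s: "T $ i $ j = T $ j $ i" for i j
    using arg_cong[OF sym, of "\<lambda>X. X $ i $ j"] by (simp add: transpose_def)
  have aa: "T $ a $ a \<noteq> 0" using minors[of a a b b] s[of b a] ab by auto
  define r where "r = csqrt (T $ a $ a)"
  have r: "r * r = T $ a $ a" using power2_csqrt[of "T $ a $ a"] by (simp add: r_def power2_eq_square)
  show thesis
  proof (rule that[of "\<lambda>i. T $ a $ i / r"])
    show "T $ i $ j = T $ a $ i / r * (T $ a $ j / r)" for i j
      using minors[of i j a a] s[of i a] aa by (simp add: r field_simps)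
  qed
qed

section \<open>Invariants of filtering\<close>

definition cnj_mat :: "complex ^ 'n ^ 'm \<Rightarrow> complex ^ 'n ^ 'm" where
  "cnj_mat X = (\<chi> i j. cnj (X $ i $ j))"

lemma cnj_mat_mult: "cnj_mat (X ** Y) = cnj_mat X ** cnj_mat Y"
  by (simp add: vec_eq_iff cnj_mat_def matrix_matrix_mult_def)

lemma cnj_mat_mscale: "cnj_mat (mscale c X) = mscale (cnj c) (cnj_mat X)"
  by (simp add: vec_eq_iff cnj_mat_def mscale_def)

lemma cnj_mat_adjoint: "cnj_mat (adjoint_mat X) = transpose X"
  by (simp add: vec_eq_iff cnj_mat_def adjoint_mat_def transpose_def)

lemma cnj_mat_transpose: "cnj_mat (transpose X) = adjoint_mat X"
  by (simp add: vec_eq_iff cnj_mat_def adjoint_mat_def transpose_def)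

text \<open>This is \<open>- \<sigma>\<^sub>2 \<otimes> \<sigma>\<^sub>2\<close>; the sign drops out of all uses.\<close>

definition spin_flip :: "complex ^ (2 \<times> 2) ^ (2 \<times> 2)" where
  "spin_flip = tensor_mat (mat22 0 1 (- 1) 0) (mat22 0 1 (- 1) 0)"

lemma cnj_mat_spin_flip [simp]: "cnj_mat spin_flip = spin_flip"
  unfolding vec_eq_iff forall_bits by (simp add: cnj_mat_def spin_flip_def tensor_mat_def)

lemma transpose_spin_flip [simp]: "transpose spin_flip = spin_flip"
  unfolding vec_eq_iff forall_bits by (simp add: transpose_def spin_flip_def tensor_mat_def)

lemma transpose_tensor: "transpose (tensor_mat A B) = tensor_mat (transpose A) (transpose B)"
  by (simp add: vec_eq_iff tensor_mat_def transpose_def)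

text \<open>The alternating form on two-dimensional space is multiplied by the determinant under a
  change of variables; this happens in each tensor factor.\<close>

lemma spin_flip_congruence:
  "transpose (tensor_mat A B) ** spin_flip ** tensor_mat A B = mscale (det A * det B) spin_flip"
proof -
  have eps: "transpose X ** mat22 0 1 (- 1) 0 ** X = mscale (det X) (mat22 0 1 (- 1) 0)" for X
    by (rule mat22_cases[of X]) (simp add: algebra_simps)
  show ?thesis by (simp add: spin_flip_def transpose_tensor tensor_mult eps tensor_mscale del: mscale_mat22)
qed

text \<open>The product of \<rho> with its spin-flipped conjugate, whose eigenvalues enter Wootters'
  formula for the concurrence.\<close>

definition concurrence_mat :: "complex ^ (2 \<times> 2) ^ (2 \<times> 2) \<Rightarrow> complex ^ (2 \<times> 2) ^ (2 \<times> 2)" where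
  "concurrence_mat \<rho> = \<rho> ** spin_flip ** cnj_mat \<rho> ** spin_flip"

lemma concurrence_mat_mscale: "concurrence_mat (mscale c \<rho>) = mscale (c * cnj c) (concurrence_mat \<rho>)"
  by (simp add: concurrence_mat_def cnj_mat_mscale mscale_mult_left mscale_mult_right mult.commute)

text \<open>Up to scalars from the two spin-flip congruences, the new matrix is a product of
  \<open>?T\<close> with a second factor, and the old matrix is that product in the opposite order.
  The trace of powers does not see the order.\<close>

lemma trace_concurrence_mat_congruence:
  fixes A B :: "complex ^ 2 ^ 2"
  defines "\<kappa> \<equiv> det A * det B * cnj (det A * det B)"
  assumes X: "X = tensor_mat A B ** \<rho> ** adjoint_mat (tensor_mat A B)"
  shows "trace (concurrence_mat X) = \<kappa> * trace (concurrence_mat \<rho>)"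
    and "trace (concurrence_mat X ** concurrence_mat X)
      = \<kappa>\<^sup>2 * trace (concurrence_mat \<rho> ** concurrence_mat \<rho>)"
proof -
  let ?T = "tensor_mat A B" and ?S = spin_flip and ?c = "det A * det B"
  let ?K = "\<rho> ** ?S ** cnj_mat \<rho>"
  have SK: "adjoint_mat ?T ** ?S ** cnj_mat ?T = mscale (cnj ?c) ?S"
    using arg_cong[OF spin_flip_congruence[of A B], of cnj_mat]
    by (simp add: cnj_mat_mult cnj_mat_mscale cnj_mat_transpose)
  have "concurrence_mat X = ?T ** \<rho> ** (adjoint_mat ?T ** ?S ** cnj_mat ?T) ** cnj_mat \<rho> ** transpose ?T ** ?S"
    by (simp add: concurrence_mat_def X cnj_mat_mult cnj_mat_adjoint matrix_mul_assoc)
  also have "\<dots> = mscale (cnj ?c) (?T ** (?K ** transpose ?T ** ?S))"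
    unfolding SK by (simp add: mscale_mult_left mscale_mult_right matrix_mul_assoc)
  finally have D: "concurrence_mat X = mscale (cnj ?c) (?T ** (?K ** transpose ?T ** ?S))" .
  have inner: "?K ** transpose ?T ** ?S ** ?T = mscale ?c (concurrence_mat \<rho>)"
  proof -
    have "?K ** transpose ?T ** ?S ** ?T = ?K ** (transpose ?T ** ?S ** ?T)"
      by (simp add: matrix_mul_assoc)
    then show ?thesis
      by (simp add: spin_flip_congruence mscale_mult_right concurrence_mat_def)
  qed
  have "trace (?T ** (?K ** transpose ?T ** ?S)) = trace (?K ** transpose ?T ** ?S ** ?T)"
    by (rule trace_mul_sym)
  then show "trace (concurrence_mat X) = \<kappa> * trace (concurrence_mat \<rho>)"
    by (simp add: D inner trace_mscale \<kappa>_def)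
  have "trace (?T ** (?K ** transpose ?T ** ?S) ** (?T ** (?K ** transpose ?T ** ?S)))
      = trace (?T ** ((?K ** transpose ?T ** ?S ** ?T) ** (?K ** transpose ?T ** ?S)))"
    by (simp add: matrix_mul_assoc)
  also have "\<dots> = trace ((?K ** transpose ?T ** ?S ** ?T) ** (?K ** transpose ?T ** ?S ** ?T))"
    by (subst trace_mul_sym) (simp add: matrix_mul_assoc)
  finally show "trace (concurrence_mat X ** concurrence_mat X)
      = \<kappa>\<^sup>2 * trace (concurrence_mat \<rho> ** concurrence_mat \<rho>)"
    by (simp add: D inner trace_mscale mscale_mult_left mscale_mult_right \<kappa>_def power2_eq_square mult_ac)
qed

lemma trace_concurrence_mat_filtered:
  obtains \<kappa> where "trace (concurrence_mat (filtered A B \<rho>)) = \<kappa> * trace (concurrence_mat \<rho>)"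
    "trace (concurrence_mat (filtered A B \<rho>) ** concurrence_mat (filtered A B \<rho>))
      = \<kappa>\<^sup>2 * trace (concurrence_mat \<rho> ** concurrence_mat \<rho>)"
proof -
  \<comment> \<open>Division by zero gives \<open>c = 0\<close>, and both identities then hold with
    \<kappa> = 0.\<close>
  define c where "c = 1 / trace (tensor_mat A B ** \<rho> ** adjoint_mat (tensor_mat A B))"
  have "filtered A B \<rho> = mscale c (tensor_mat A B ** \<rho> ** adjoint_mat (tensor_mat A B))"
    by (simp add: filtered_def Let_def c_def)
  then show thesis
    by (intro that[of "c * cnj c * (det A * det B * cnj (det A * det B))"])
      (simp_all add: concurrence_mat_mscale trace_concurrence_mat_congruence[OF refl] trace_mscale
        mscale_mult_left mscale_mult_right power2_eq_square mult_ac)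
qed

text \<open>\<open>T\<close> is the Gram matrix of the columns of \<open>Y\<close> under the
  bilinear form \<open>spin_flip\<close>. The concurrence matrix factors as \<open>Y ** ?Z\<close>,
  while \<open>?Z ** Y\<close> is the adjoint of \<open>T\<close> times \<open>T\<close>; cyclicity
  compares the traces.\<close>

lemma concurrence_mat_trace_gram:
  fixes Y :: "complex ^ (2 \<times> 2) ^ (2 \<times> 2)"
  defines "T \<equiv> transpose Y ** spin_flip ** Y"
  shows "transpose T = T"
    and "trace (concurrence_mat (Y ** adjoint_mat Y)) = trace (adjoint_mat T ** T)"
    and "trace (concurrence_mat (Y ** adjoint_mat Y) ** concurrence_mat (Y ** adjoint_mat Y))
      = trace (adjoint_mat T ** T ** (adjoint_mat T ** T))"
proof -
  show "transpose T = T"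
    by (simp add: T_def matrix_transpose_mul matrix_mul_assoc)
  then have "adjoint_mat T = cnj_mat T" by (metis cnj_mat_transpose)
  then have adj: "adjoint_mat T = adjoint_mat Y ** spin_flip ** cnj_mat Y"
    by (simp add: T_def cnj_mat_mult cnj_mat_transpose)
  let ?Z = "adjoint_mat Y ** spin_flip ** cnj_mat Y ** transpose Y ** spin_flip"
  have D: "concurrence_mat (Y ** adjoint_mat Y) = Y ** ?Z"
    by (simp add: concurrence_mat_def cnj_mat_mult cnj_mat_adjoint matrix_mul_assoc)
  have ZY: "?Z ** Y = adjoint_mat T ** T" by (simp add: adj) (simp add: T_def matrix_mul_assoc)
  show "trace (concurrence_mat (Y ** adjoint_mat Y)) = trace (adjoint_mat T ** T)"
    unfolding D ZY[symmetric] by (rule trace_mul_sym)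
  have "trace (Y ** ?Z ** (Y ** ?Z)) = trace (Y ** (?Z ** Y ** ?Z))"
    by (simp add: matrix_mul_assoc)
  also have "\<dots> = trace (?Z ** Y ** (?Z ** Y))"
    by (subst trace_mul_sym) (simp add: matrix_mul_assoc)
  finally show "trace (concurrence_mat (Y ** adjoint_mat Y) ** concurrence_mat (Y ** adjoint_mat Y))
      = trace (adjoint_mat T ** T ** (adjoint_mat T ** T))"
    unfolding D ZY[symmetric] .
qed

text \<open>The singlet projector is real, idempotent and fixed by multiplication with
  \<open>spin_flip\<close>, so it is its own concurrence matrix.\<close>

lemma concurrence_mat_singlet:
  "trace (concurrence_mat singlet) = 1" "trace (concurrence_mat singlet ** concurrence_mat singlet) = 1"
proof -
  have "singlet ** spin_flip = singlet"
    unfolding vec_eq_iff forall_bits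
    by (simp add: matrix_matrix_mult_def sum_bits sum_bit singlet_nth spin_flip_def tensor_mat_def)
  moreover have "singlet ** singlet = singlet" "cnj_mat singlet = singlet"
    unfolding vec_eq_iff forall_bits
    by (simp_all add: matrix_matrix_mult_def sum_bits sum_bit singlet_nth cnj_mat_def)
  ultimately have "concurrence_mat singlet = singlet" "singlet ** singlet = singlet"
    by (simp_all add: concurrence_mat_def flip: matrix_mul_assoc)
  moreover have "trace singlet = 1"
    by (simp add: trace_def sum_bits sum_bit singlet_nth)
  ultimately show "trace (concurrence_mat singlet) = 1"
    "trace (concurrence_mat singlet ** concurrence_mat singlet) = 1" by simp_all
qed

section \<open>Passage to the limit and comparison of matrix norms\<close>

lemma tendsto_matrix_mult:
  fixes f :: "'a \<Rightarrow> complex ^ 'n ^ 'm" and g :: "'a \<Rightarrow> complex ^ 'k ^ 'n"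
  assumes "(f \<longlongrightarrow> X) F" "(g \<longlongrightarrow> Y) F"
  shows "((\<lambda>x. f x ** g x) \<longlongrightarrow> X ** Y) F"
  unfolding matrix_matrix_mult_def by (intro tendsto_intros assms)

lemma tendsto_cnj_mat: "(f \<longlongrightarrow> X) F \<Longrightarrow> ((\<lambda>x. cnj_mat (f x)) \<longlongrightarrow> cnj_mat X) F"
  unfolding cnj_mat_def by (intro tendsto_intros)

lemma tendsto_trace:
  fixes f :: "'a \<Rightarrow> complex ^ 'n ^ 'n"
  shows "(f \<longlongrightarrow> X) F \<Longrightarrow> ((\<lambda>x. trace (f x)) \<longlongrightarrow> trace X) F"
  unfolding trace_def by (intro tendsto_intros)

lemma tendsto_concurrence_mat:
  "(f \<longlongrightarrow> X) F \<Longrightarrow> ((\<lambda>x. concurrence_mat (f x)) \<longlongrightarrow> concurrence_mat X) F"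
  unfolding concurrence_mat_def by (intro tendsto_matrix_mult tendsto_cnj_mat tendsto_const)

text \<open>Equivalence of norms in finite dimension: expansion in matrix units makes
  \<open>N\<close> Lipschitz, so it attains a positive minimum on the compact unit sphere. This
  turns smallness in \<open>N\<close> into convergence.\<close>

lemma matrix_norm_dominates:
  fixes N :: "complex ^ 'n ^ 'm \<Rightarrow> real"
  assumes N: "matrix_norm N"
  obtains C where "C > 0" "\<And>X. norm X \<le> C * N X"
proof -
  have N0: "N X \<ge> 0" "N X = 0 \<longleftrightarrow> X = 0" "N (mscale c X) = cmod c * N X" "N (X + Y) \<le> N X + N Y" for c X Y
    using N by (auto simp: matrix_norm_def)
  define E :: "'m \<Rightarrow> 'n \<Rightarrow> complex ^ 'n ^ 'm"
    where "E a b = (\<chi> i j. if i = a \<and> j = b then 1 else 0)" for a b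
  have N_sum: "N (sum f S) \<le> (\<Sum>i\<in>S. N (f i))" for S and f :: "'c \<Rightarrow> _"
  proof (induction S rule: infinite_finite_induct)
    case (insert x S)
    then show ?case using N0(4)[of "f x" "sum f S"] by simp
  qed (simp_all add: N0(2)[THEN iffD2])
  define K where "K = (\<Sum>a\<in>UNIV. \<Sum>b\<in>UNIV. N (E a b))"
  have bound: "N X \<le> K * norm X" for X
  proof -
    have "X = (\<Sum>a\<in>UNIV. \<Sum>b\<in>UNIV. mscale (X $ a $ b) (E a b))"
    proof -
      have "(\<Sum>b\<in>UNIV. X $ a $ b * (if i = a \<and> j = b then 1 else 0)) = (if i = a then X $ a $ j else 0)" for a i j
        by (cases "i = a") (simp_all add: if_distrib[of "(*) _"] cong: if_cong)
      then show ?thesis by (simp add: vec_eq_iff mscale_def E_def)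
    qed
    then have "N X = N (\<Sum>a\<in>UNIV. \<Sum>b\<in>UNIV. mscale (X $ a $ b) (E a b))" by simp
    also have "\<dots> \<le> (\<Sum>a\<in>UNIV. \<Sum>b\<in>UNIV. N (mscale (X $ a $ b) (E a b)))"
      by (intro order_trans[OF N_sum] sum_mono N_sum)
    also have "\<dots> \<le> (\<Sum>a\<in>UNIV. \<Sum>b\<in>UNIV. norm X * N (E a b))"
    proof (intro sum_mono)
      fix a b
      have "cmod (X $ a $ b) \<le> norm X"
        by (rule order_trans[OF Finite_Cartesian_Product.norm_nth_le Finite_Cartesian_Product.norm_nth_le])
      then show "N (mscale (X $ a $ b) (E a b)) \<le> norm X * N (E a b)"
        by (simp add: N0(3) mult_right_mono N0(1))
    qed
    finally show ?thesis by (simp add: K_def sum_distrib_left mult.commute)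
  qed
  have "K \<ge> 0" unfolding K_def by (intro sum_nonneg N0(1))
  have minus: "N (X - Y) = N (Y - X)" for X Y
  proof -
    have "mscale (- 1) (Y - X) = X - Y" by (simp add: vec_eq_iff mscale_def)
    then show ?thesis using N0(3)[of "- 1" "Y - X"] by simp
  qed
  have "\<bar>N X - N Y\<bar> \<le> K * dist X Y" for X Y
  proof -
    have "\<bar>N X - N Y\<bar> \<le> N (X - Y)"
      using N0(4)[of "X - Y" Y] N0(4)[of "Y - X" X] minus[of X Y] by simp
    then show ?thesis using bound[of "X - Y"] by (simp add: dist_norm)
  qed
  then have "K-lipschitz_on UNIV N" using \<open>K \<ge> 0\<close> by (intro lipschitz_onI) (auto simp: dist_real_def)
  then have "continuous_on (sphere 0 1) N"
    using lipschitz_on_continuous_on continuous_on_subset by blast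
  moreover have "sphere (0 :: complex ^ 'n ^ 'm) 1 \<noteq> {}" by simp
  ultimately obtain X0 where X0: "norm X0 = 1" "\<And>X. norm X = 1 \<Longrightarrow> N X0 \<le> N X"
    using continuous_attains_inf[OF compact_sphere, of 0 1 N] by auto
  have "N X0 > 0" using N0(1)[of X0] N0(2)[of X0] X0(1) by (cases "N X0 = 0") auto
  have "norm X \<le> (1 / N X0) * N X" for X
  proof (cases "X = 0")
    case False
    let ?U = "mscale (of_real (1 / norm X)) X"
    have "?U = (1 / norm X) *\<^sub>R X"
      by (simp add: vec_eq_iff mscale_def scaleR_conv_of_real[where 'a = complex])
    then have "norm ?U = 1" using False by simp
    then have "N X0 \<le> N ?U" by (rule X0(2))
    also have "\<dots> = N X / norm X" by (simp add: N0(3) norm_divide)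
    finally show ?thesis using \<open>N X0 > 0\<close> False by (simp add: field_simps)
  qed (simp add: N0(2)[THEN iffD2])
  then show thesis using that[of "1 / N X0"] \<open>N X0 > 0\<close> by simp
qed

text \<open>Along filtered states that tend to the singlet both traces tend to 1, while they are the
  traces for \<rho> times \<kappa> and its square.\<close>

lemma quasi_purifiable_concurrence:
  assumes N: "matrix_norm N" and qp: "quasi_purifiable N \<rho>"
  shows "trace (concurrence_mat \<rho>) \<noteq> 0"
    and "(trace (concurrence_mat \<rho>))\<^sup>2 = trace (concurrence_mat \<rho> ** concurrence_mat \<rho>)"
proof -
  let ?F = "\<lambda>X. trace (concurrence_mat X)" and ?G = "\<lambda>X. trace (concurrence_mat X ** concurrence_mat X)"
  obtain C where C: "C > 0" "\<And>X. norm X \<le> C * N X" by (rule matrix_norm_dominates[OF N]) blast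
  have "\<exists>A B. N (filtered A B \<rho> - singlet) < 1 / real (Suc n)" for n
    using qp unfolding quasi_purifiable_def by (meson of_nat_0_less_iff zero_less_Suc zero_less_divide_1_iff)
  then obtain A B where AB: "\<And>n. N (filtered (A n) (B n) \<rho> - singlet) < 1 / real (Suc n)" by metis
  define f where "f n = filtered (A n) (B n) \<rho>" for n
  have "f \<longlonglongrightarrow> singlet"
  proof (rule LIM_zero_cancel, rule Lim_null_comparison)
    show "\<forall>\<^sub>F n in sequentially. norm (f n - singlet) \<le> C * (1 / real (Suc n))"
      using C AB unfolding f_def by (intro always_eventually allI) (meson less_imp_le mult_left_mono order_trans)
    show "(\<lambda>n. C * (1 / real (Suc n))) \<longlonglongrightarrow> 0"
      using tendsto_mult_right_zero[OF LIMSEQ_inverse_real_of_nat, of C] by (simp add: divide_inverse)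
  qed
  then have D: "(\<lambda>n. concurrence_mat (f n)) \<longlonglongrightarrow> concurrence_mat singlet"
    by (rule tendsto_concurrence_mat)
  have lim: "(\<lambda>n. ?F (f n)) \<longlonglongrightarrow> 1" "(\<lambda>n. ?G (f n)) \<longlonglongrightarrow> 1"
    using tendsto_trace[OF D] tendsto_trace[OF tendsto_matrix_mult[OF D D]]
    by (simp_all only: concurrence_mat_singlet)
  have "\<exists>\<kappa>. ?F (f n) = \<kappa> * ?F \<rho> \<and> ?G (f n) = \<kappa>\<^sup>2 * ?G \<rho>" for n
    unfolding f_def by (rule trace_concurrence_mat_filtered) blast
  then obtain \<kappa> where \<kappa>: "\<And>n. ?F (f n) = \<kappa> n * ?F \<rho>" "\<And>n. ?G (f n) = (\<kappa> n)\<^sup>2 * ?G \<rho>" by metis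
  show "?F \<rho> \<noteq> 0"
  proof
    assume "?F \<rho> = 0"
    then have "(\<lambda>n. 0 :: complex) \<longlonglongrightarrow> 1" using lim(1) by (simp add: \<kappa>)
    then show False by (simp add: LIMSEQ_const_iff)
  qed
  \<comment> \<open>Both sides scale alike, so the ratio is compared without division and \<kappa>
    drops out in the limit.\<close>
  have "?G (f n) * (?F \<rho>)\<^sup>2 = ?G \<rho> * (?F (f n))\<^sup>2" for n
    by (simp add: \<kappa> power_mult_distrib)
  moreover have "(\<lambda>n. ?G (f n) * (?F \<rho>)\<^sup>2) \<longlonglongrightarrow> 1 * (?F \<rho>)\<^sup>2"
    by (intro tendsto_intros lim)
  moreover have "(\<lambda>n. ?G \<rho> * (?F (f n))\<^sup>2) \<longlonglongrightarrow> ?G \<rho> * 1\<^sup>2"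
    by (intro tendsto_intros lim)
  ultimately show "(?F \<rho>)\<^sup>2 = ?G \<rho>"
    using LIMSEQ_unique by fastforce
qed

section \<open>Reduction to the normal form\<close>

text \<open>The symmetric bilinear form normalized so that its diagonal is twice the determinant. On
  coefficient matrices of vectors it is the bilinear form of \<open>spin_flip\<close>.\<close>

definition det_polar :: "complex ^ 2 ^ 2 \<Rightarrow> complex ^ 2 ^ 2 \<Rightarrow> complex" where
  "det_polar X Y = X $ 0 $ 0 * Y $ 1 $ 1 - X $ 0 $ 1 * Y $ 1 $ 0 - X $ 1 $ 0 * Y $ 0 $ 1 + X $ 1 $ 1 * Y $ 0 $ 0"

lemma det_polar_self: "det_polar X X = 2 * det X"
  by (rule mat22_cases[of X]) (simp add: det_polar_def algebra_simps)

lemma det_polar_mult: "det_polar (C ** X) (C ** Y) = det C * det_polar X Y"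
  by (rule mat22_cases[of C], rule mat22_cases[of X], rule mat22_cases[of Y])
    (simp add: det_polar_def algebra_simps)

lemma det_polar_commute: "det_polar X Y = det_polar Y X"
  by (simp add: det_polar_def algebra_simps)

lemma det_polar_diff_right: "det_polar X (Y - Z) = det_polar X Y - det_polar X Z"
  by (simp add: det_polar_def algebra_simps)

lemma det_polar_mscale_right: "det_polar X (mscale c Y) = c * det_polar X Y"
  by (simp add: det_polar_def mscale_def algebra_simps)

lemma det_polar_sum_right: "det_polar X (\<Sum>a\<in>K. f a) = (\<Sum>a\<in>K. det_polar X (f a))"
  by (simp add: det_polar_def sum_distrib_left sum.distrib sum_subtractf)

text \<open>On traceless 2 x 2 matrices the determinant is a nondegenerate form in three dimensions,
  so a totally isotropic family lies on one line spanned by a nilpotent; \<open>h\<close> conjugates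
  this nilpotent to its Jordan form. If all upper right entries vanish, the family already has that
  form.\<close>

lemma isotropic_traceless_common_form:
  fixes M :: "'a \<Rightarrow> complex ^ 2 ^ 2"
  assumes tr: "\<And>a. trace (M a) = 0" and iso: "\<And>a b. det_polar (M a) (M b) = 0"
  obtains h where "det h = 1" "\<And>a. \<exists>c. M a ** h = mscale c (h ** mat22 0 0 1 0)"
proof (cases "\<exists>a. M a $ 0 $ 1 \<noteq> 0")
  case False
  show thesis
  proof (rule that[of "mat 1"])
    fix a
    obtain x y z w where M: "M a = mat22 x y z w" by (rule mat22_cases)
    have "y = 0" using False M by (metis mat22_nth(2))
    moreover have "w = - x" using tr[of a] M by (simp add: eq_neg_iff_add_eq_0 add.commute)
    ultimately have "x * x = 0" using iso[of a a] by (simp add: M det_polar_self)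
    then have "M a ** mat 1 = mscale z (mat 1 ** mat22 0 0 1 0)"
      using \<open>y = 0\<close> \<open>w = - x\<close> M by simp
    then show "\<exists>c. M a ** mat 1 = mscale c (mat 1 ** mat22 0 0 1 0)" ..
  qed simp
next
  case True
  then obtain b where b: "M b $ 0 $ 1 \<noteq> 0" by blast
  obtain x y z w where Mb: "M b = mat22 x y z w" by (rule mat22_cases)
  have "w = - x" using tr[of b] Mb by (simp add: eq_neg_iff_add_eq_0 add.commute)
  have "y \<noteq> 0" using b Mb by simp
  have "x * w - y * z = 0" using iso[of b b] by (simp add: Mb det_polar_self)
  then have xyz: "x * x + y * z = 0" using \<open>w = - x\<close> by algebra
  define r where "r = csqrt (- y)"
  have "r\<^sup>2 = - y" "r \<noteq> 0" using \<open>y \<noteq> 0\<close> by (simp_all add: r_def)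
  \<comment> \<open>The columns form a Jordan chain, the second axis and its image under
    \<open>M b\<close>, scaled to determinant 1.\<close>
  define h where "h = mscale (1 / r) (mat22 0 y 1 (- x))"
  show thesis
  proof (rule that[of h])
    show "det h = 1"
      using \<open>y \<noteq> 0\<close> by (simp add: h_def det_mscale_22 power_divide \<open>r\<^sup>2 = - y\<close> del: mscale_mat22)
    fix a
    obtain x' y' z' w' where Ma: "M a = mat22 x' y' z' w'" by (rule mat22_cases)
    have w': "w' = - x'" using tr[of a] Ma by (simp add: eq_neg_iff_add_eq_0 add.commute)
    have "x' * w' - y' * z' = 0" using iso[of a a] by (simp add: Ma det_polar_self)
    then have 1: "x' * x' + y' * z' = 0" using w' by algebra
    have 2: "2 * x * x' + y * z' + z * y' = 0"
    proof -
      have "x * w' - y * z' - z * y' + w * x' = 0"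
        using iso[of b a] unfolding Ma Mb det_polar_def mat22_nth .
      then show ?thesis using w' \<open>w = - x\<close> by algebra
    qed
    \<comment> \<open>Isotropy of both matrices and their orthogonality make this square vanish; so
      their first rows are proportional, and the remaining entries follow.\<close>
    have "(x * y' - x' * y)\<^sup>2 = 0" using 1 2 xyz by algebra
    then have x': "x' * y = x * y'" by simp
    have "y * (z' * y) = y * (z * y')" using 2 x' xyz by algebra
    then have z': "z' * y = z * y'" using \<open>y \<noteq> 0\<close> by simp
    have "y * (x' * x + y' * z) = 0" using x' xyz by algebra
    then have 3: "x' * x + y' * z = 0" using \<open>y \<noteq> 0\<close> by simp
    have "M a ** mat22 0 y 1 (- x) = mscale (y' / y) (mat22 0 y 1 (- x) ** mat22 0 0 1 0)"
      using \<open>y \<noteq> 0\<close> x' z' 3 by (simp add: Ma w' field_simps)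
    then have "M a ** h = mscale (y' / y) (h ** mat22 0 0 1 0)"
      unfolding h_def by (simp only: mscale_mult_left mscale_mult_right mscale_mscale mult.commute)
    then show "\<exists>c. M a ** h = mscale c (h ** mat22 0 0 1 0)" ..
  qed
qed

text \<open>Multiplication by the inverse of the rescaled \<open>V\<close> turns orthogonality to
  \<open>V\<close> into vanishing trace, so \<open>isotropic_traceless_common_form\<close> applies
  to the family \<open>W\<close>.\<close>

lemma canonical_form_of_pencil:
  fixes W :: "'a::finite \<Rightarrow> complex ^ 2 ^ 2" and n :: real
  assumes n: "n > 0" and V: "det_polar V V = of_real n"
    and VW: "\<And>a. det_polar V (W a) = 0" and WW: "\<And>a b. det_polar (W a) (W b) = 0"
    and \<rho>: "\<And>i j. \<rho> $ i $ j = V $ fst i $ snd i * cnj (V $ fst j $ snd j) +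
              (\<Sum>a\<in>UNIV. W a $ fst i $ snd i * cnj (W a $ fst j $ snd j))"
  obtains A B q where "det A = 1" "det B = 1"
    "\<rho> = tensor_mat A B ** canonical_state n q n ** adjoint_mat (tensor_mat A B)"
proof -
  \<comment> \<open>The determinant of \<open>V\<close> is n / 2 because \<open>det_polar\<close>
    doubles it.\<close>
  define \<delta> where "\<delta> = sqrt (n / 2)"
  have \<delta>: "\<delta> > 0" "\<delta> * \<delta> = n / 2" using n by (simp_all add: \<delta>_def)
  have detV: "det V = of_real (\<delta> * \<delta>)" using V by (simp add: det_polar_self \<delta>(2) mult.commute)
  define V1 where "V1 = mscale (1 / of_real \<delta>) V"
  have "det V1 = 1" using \<delta>(1) by (simp add: V1_def det_mscale_22 detV power2_eq_square)
  have VV1: "V = mscale (of_real \<delta>) V1" using \<delta>(1) by (simp add: V1_def)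
  obtain U where U: "det U = 1" "V1 ** U = mat 1" "U ** V1 = mat 1" using unimodular_inverse[OF \<open>det V1 = 1\<close>] .
  have "det_polar V1 (W a) = 0" for a
    using VW[of a] \<delta>(1) unfolding VV1
    by (simp add: det_polar_commute[of _ "W a"] det_polar_mscale_right)
  then have "det_polar (mat 1) (U ** W a) = 0" for a
    using det_polar_mult[of U V1 "W a"] by (simp add: U)
  then have tr: "trace (U ** W a) = 0" for a
    by (simp add: mat_1_mat22 det_polar_def trace_def sum_bit add.commute)
  have iso: "det_polar (U ** W a) (U ** W b) = 0" for a b
    by (simp add: det_polar_mult WW)
  obtain h where h: "det h = 1" "\<And>a. \<exists>c. U ** W a ** h = mscale c (h ** mat22 0 0 1 0)"
    by (rule isotropic_traceless_common_form[of "\<lambda>a. U ** W a", OF tr iso]) blast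
  then obtain c where c: "\<And>a. U ** W a ** h = mscale (c a) (h ** mat22 0 0 1 0)" by metis
  obtain g where g: "det g = 1" "h ** g = mat 1" "g ** h = mat 1" using unimodular_inverse[OF h(1)] .
  \<comment> \<open>A local map acts on a coefficient matrix X by
    \<open>A ** X ** transpose B\<close>. With this choice the identity, which represents |00> +
    |11>, goes to \<open>V1\<close>, and the nilpotent, which represents |10>, goes to a matrix
    proportional to each \<open>W a\<close>.\<close>
  define A where "A = V1 ** h"
  define B where "B = transpose g"
  have AB: "det A = 1" "det B = 1" by (simp_all add: A_def B_def det_mul det_transpose h g \<open>det V1 = 1\<close>)
  have "A ** transpose B = V1"
    by (simp add: A_def B_def g flip: matrix_mul_assoc)
  then have V_eq: "V = mscale (of_real \<delta>) (A ** transpose B)" by (simp add: VV1)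
  have W_eq: "W a = mscale (c a) (A ** mat22 0 0 1 0 ** transpose B)" for a
  proof -
    have "W a = V1 ** (U ** W a ** h) ** g"
      by (metis U(2) g(2) matrix_mul_assoc matrix_mul_lid matrix_mul_rid)
    then show ?thesis
      unfolding c by (simp add: A_def B_def mscale_mult_left mscale_mult_right matrix_mul_assoc)
  qed
  define q where "q = (\<Sum>a\<in>UNIV. (cmod (c a))\<^sup>2)"
  have V_nth: "V $ i $ j = of_real \<delta> * (A $ i $ 0 * B $ j $ 0 + A $ i $ 1 * B $ j $ 1)" for i j
    by (simp add: V_eq mscale_def matrix_matrix_mult_def transpose_def sum_bit)
  have W_nth: "W a $ i $ j = c a * (A $ i $ 1 * B $ j $ 0)" for a i j
    by (simp add: W_eq mscale_def matrix_matrix_mult_def transpose_def sum_bit)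
  have "\<rho> = tensor_mat A B ** canonical_state n q n ** adjoint_mat (tensor_mat A B)"
  proof -
    have "\<rho> $ i $ j = (tensor_mat A B ** canonical_state n q n ** adjoint_mat (tensor_mat A B)) $ i $ j" for i j
    proof -
      let ?v = "\<lambda>i :: 2 \<times> 2. A $ fst i $ 0 * B $ snd i $ 0 + A $ fst i $ 1 * B $ snd i $ 1"
      let ?w = "\<lambda>i :: 2 \<times> 2. A $ fst i $ 1 * B $ snd i $ 0"
      have "\<rho> $ i $ j = of_real (\<delta> * \<delta>) * (?v i * cnj (?v j)) + (\<Sum>a\<in>UNIV. c a * cnj (c a)) * (?w i * cnj (?w j))"
        by (simp add: \<rho> V_nth W_nth sum_distrib_left sum_distrib_right mult_ac)
      also have "(\<Sum>a\<in>UNIV. c a * cnj (c a)) = of_real q"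
        by (simp add: q_def complex_norm_square del: of_real_power)
      finally show ?thesis
        by (simp add: matrix_matrix_mult_def adjoint_mat_def tensor_mat_def canonical_state_def sum_bits sum_bit
            \<delta>(2) algebra_simps)
    qed
    then show ?thesis by (simp add: vec_eq_iff)
  qed
  then show thesis using that AB by blast
qed

text \<open>The columns of a Cholesky factor have a Gram matrix of rank one with entries
  \<open>t a * t b\<close>; regrouping them along the vector \<open>t\<close> yields the data of
  \<open>canonical_form_of_pencil\<close>.\<close>

lemma canonical_form_exists:
  assumes psd: "psd \<rho>" and nz: "trace (concurrence_mat \<rho>) \<noteq> 0"
    and sq: "(trace (concurrence_mat \<rho>))\<^sup>2 = trace (concurrence_mat \<rho> ** concurrence_mat \<rho>)"
  obtains A B p q where "det A = 1" "det B = 1" "p > 0"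
    "\<rho> = tensor_mat A B ** canonical_state p q p ** adjoint_mat (tensor_mat A B)"
proof -
  obtain Y :: "complex ^ (2 \<times> 2) ^ (2 \<times> 2)" where Y: "\<rho> = Y ** adjoint_mat Y" using psd_cholesky[OF psd] .
  define T where "T = transpose Y ** spin_flip ** Y"
  note gram = concurrence_mat_trace_gram[of Y, folded T_def Y]
  obtain t where t: "\<And>a b. T $ a $ b = t a * t b"
    using symmetric_rank_one[OF gram(1)] minors_eq_0I[of T] sq gram(2,3) by metis
  define C where "C a = (\<chi> i j. Y $ (i, j) $ a)" for a
  have polar_C: "det_polar (C a) (C b) = t a * t b" for a b
  proof -
    have "T $ a $ b = det_polar (C a) (C b)"
      by (simp add: T_def det_polar_def C_def matrix_matrix_mult_def transpose_def spin_flip_def tensor_mat_def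
          sum_bits sum_bit algebra_simps)
    then show ?thesis by (simp add: t)
  qed
  define n where "n = (\<Sum>a\<in>UNIV. (cmod (t a))\<^sup>2)"
  have n: "of_real n = (\<Sum>a\<in>UNIV. cnj (t a) * t a)"
    by (simp add: n_def complex_norm_square mult.commute del: of_real_power)
  have "n \<noteq> 0"
  proof
    assume "n = 0"
    then have "\<forall>a\<in>UNIV. (cmod (t a))\<^sup>2 = 0"
      unfolding n_def by (subst (asm) sum_nonneg_eq_0_iff) auto
    from bspec[OF this UNIV_I] have "t a = 0" for a by simp
    then have "T = 0" by (simp add: vec_eq_iff t)
    then show False using nz gram(2) by (simp add: trace_def matrix_matrix_mult_def)
  qed
  then have "n > 0" using sum_nonneg[of UNIV "\<lambda>a. (cmod (t a))\<^sup>2"] by (simp add: n_def)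
  define r where "r = complex_of_real (sqrt n)"
  have r: "r * r = of_real n" "cnj r = r" "r \<noteq> 0"
    using \<open>n > 0\<close> by (simp_all add: r_def flip: of_real_mult)
  \<comment> \<open>Let u be the conjugate of \<open>t\<close> divided by \<open>r\<close>, a unit
    vector. Then \<open>V\<close> is \<open>Y\<close> applied to u, and the \<open>W a\<close> are
    the columns of \<open>Y\<close> times the projection onto the complement of u. Hence \<rho>
    splits as a sum, and the rank-one Gram matrix vanishes on that complement.\<close>
  define V where "V = mscale (1 / r) (\<Sum>a\<in>UNIV. mscale (cnj (t a)) (C a))"
  define W where "W a = C a - mscale (t a / r) V" for a
  have CV: "det_polar (C b) V = r * t b" for b
  proof -
    have "det_polar (C b) V = (1 / r) * (\<Sum>a\<in>UNIV. cnj (t a) * (t b * t a))"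
      by (simp add: V_def det_polar_mscale_right det_polar_sum_right polar_C)
    also have "(\<Sum>a\<in>UNIV. cnj (t a) * (t b * t a)) = t b * of_real n"
      by (simp add: n sum_distrib_left mult_ac)
    finally show ?thesis using r(3) by (simp flip: r(1))
  qed
  have VV: "det_polar V V = of_real n"
  proof -
    have "det_polar V V = (1 / r) * (\<Sum>a\<in>UNIV. cnj (t a) * det_polar V (C a))"
      by (subst (2) V_def) (simp add: det_polar_mscale_right det_polar_sum_right)
    also have "(\<Sum>a\<in>UNIV. cnj (t a) * det_polar V (C a)) = r * of_real n"
      by (simp add: det_polar_commute[of V] CV n sum_distrib_left mult_ac)
    finally show ?thesis using r(3) by simp
  qed
  have VW: "det_polar V (W a) = 0" for a
    using r(3) by (simp add: W_def det_polar_diff_right det_polar_mscale_right det_polar_commute[of V "C a"] CV VV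
        flip: r(1))
  have WW: "det_polar (W a) (W b) = 0" for a b
  proof -
    have "det_polar (W a) (W b) = det_polar (W a) (C b)"
      by (subst (2) W_def) (simp add: det_polar_diff_right det_polar_mscale_right det_polar_commute[of "W a" V] VW)
    also have "\<dots> = det_polar (C b) (W a)" by (rule det_polar_commute)
    also have "\<dots> = 0"
      using r(3) by (simp add: W_def det_polar_diff_right det_polar_mscale_right CV polar_C)
    finally show ?thesis .
  qed
  have \<rho>: "\<rho> $ i $ j = V $ fst i $ snd i * cnj (V $ fst j $ snd j) +
      (\<Sum>a\<in>UNIV. W a $ fst i $ snd i * cnj (W a $ fst j $ snd j))" for i j
  proof -
    let ?V = "\<lambda>i. V $ fst i $ snd i"
    have V: "(\<Sum>a\<in>UNIV. cnj (t a) * Y $ i $ a) = r * ?V i" for i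
      using r(3) by (simp add: V_def mscale_def C_def)
    have V': "(\<Sum>a\<in>UNIV. t a * cnj (Y $ i $ a)) = r * cnj (?V i)" for i
      using arg_cong[OF V[of i], of cnj] r(2) by simp
    have "(\<Sum>a\<in>UNIV. W a $ fst i $ snd i * cnj (W a $ fst j $ snd j)) =
      (\<Sum>a\<in>UNIV. Y $ i $ a * cnj (Y $ j $ a) - (?V i / r) * (t a * cnj (Y $ j $ a))
         - (cnj (?V j) / r) * (cnj (t a) * Y $ i $ a) + (?V i * cnj (?V j) / (r * r)) * (cnj (t a) * t a))"
      by (intro sum.cong) (simp_all add: W_def C_def mscale_def r(2) algebra_simps)
    also have "\<dots> = \<rho> $ i $ j - (?V i / r) * (r * cnj (?V j)) - (cnj (?V j) / r) * (r * ?V i)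
        + (?V i * cnj (?V j) / (r * r)) * of_real n"
      unfolding sum.distrib sum_subtractf sum_distrib_left[symmetric] V V' n[symmetric]
      by (simp add: Y matrix_matrix_mult_def adjoint_mat_def)
    finally show ?thesis using r(3) by (simp flip: r(1))
  qed
  show thesis
    by (rule canonical_form_of_pencil[OF \<open>n > 0\<close> VV VW WW \<rho>]) (use that \<open>n > 0\<close> in blast)
qed

theorem mainTheorem7:
  fixes \<rho> :: "complex ^ (2 \<times> 2) ^ (2 \<times> 2)"
    and R :: "real ^ 4 ^ 4"
    and N :: "complex ^ (2 \<times> 2) ^ (2 \<times> 2) \<Rightarrow> real"
  assumes "matrix_norm N"
    and "density_matrix \<rho>"
    and "rank \<rho> \<ge> 2"
    and "\<And>i j. complex_of_real (R $ i $ j) = trace (\<rho> ** tensor_mat (pauli i) (pauli j))"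
  shows "quasi_purifiable N \<rho> \<longleftrightarrow>
    rank \<rho> = 2 \<and>
    (\<exists>L1 L2 a b c d. proper_orthochronous L1 \<and> proper_orthochronous L2 \<and>
       R = L1 ** Sigma_form a b c d ** transpose L2 \<and>
       a - b = a + c \<and> a + c = \<bar>d\<bar>)"
proof -
  have R: "correlation_matrix \<rho> R" using assms(4) by (simp add: correlation_matrix_def)
  show ?thesis
  proof (intro iffI)
    assume "quasi_purifiable N \<rho>"
    note inv = quasi_purifiable_concurrence[OF assms(1) this]
    have "psd \<rho>" using assms(2) by (simp add: density_matrix_def)
    then obtain A B p q where AB: "det A = 1" "det B = 1" "p > 0"
      and eq: "\<rho> = tensor_mat A B ** canonical_state p q p ** adjoint_mat (tensor_mat A B)"
      using canonical_form_exists inv by metis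
    have "rank \<rho> \<le> 2" unfolding eq using AB(3) by (intro rank_canonical_congruence(1)) simp
    then have "rank \<rho> = 2" using assms(3) by simp
    moreover have "correlation_matrix \<rho>
        (spinor_map A ** Sigma_form (p + q) q (- q) p ** transpose (spinor_map B))"
      unfolding eq by (rule correlation_matrix_congruence[OF correlation_matrix_canonical])
    then have "R = spinor_map A ** Sigma_form (p + q) q (- q) p ** transpose (spinor_map B)"
      using R unfolding correlation_matrix_def by (metis (no_types, lifting) of_real_eq_iff vec_eq_iff)
    ultimately show "rank \<rho> = 2 \<and>
      (\<exists>L1 L2 a b c d. proper_orthochronous L1 \<and> proper_orthochronous L2 \<and>
         R = L1 ** Sigma_form a b c d ** transpose L2 \<and> a - b = a + c \<and> a + c = \<bar>d\<bar>)"
      using AB by (intro conjI exI[of _ "spinor_map A"] exI[of _ "spinor_map B"] exI[of _ "p + q"]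
          exI[of _ q] exI[of _ "- q"] exI[of _ p]) (simp_all add: proper_orthochronous_spinor_map)
  next
    assume "rank \<rho> = 2 \<and>
      (\<exists>L1 L2 a b c d. proper_orthochronous L1 \<and> proper_orthochronous L2 \<and>
         R = L1 ** Sigma_form a b c d ** transpose L2 \<and> a - b = a + c \<and> a + c = \<bar>d\<bar>)"
    then show "quasi_purifiable N \<rho>"
      using quasi_purifiable_if_Sigma_form[OF assms(1,3) R] by blast
  qed
qed

end
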